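(* (PD Noether theorem) Let $\omega$ be a PD prehamiltonian system on a fiber bundle $\alpha:P\to M$ with connected fiber, $\dim M=n$. Let $Y\in\mathscr{S}(\omega)$ and $f\in\mathscr{C}(\omega)$ be a PD Noether symmetry and a PD Noether current of $\omega$ relative to each other. Then $\sigma^*(f)\in\Lambda^{n-1}(M)$ is a closed form (on the domain of $\sigma$) for every solution $\sigma$ of the PD Hamilton equations of $\omega$.
   Context: Everything is smooth. $V\mathrm{D}$ is the module of $\alpha$-vertical vector fields on $P$. $\Lambda_p^k$ is the module of $k$-forms $\omega$ on $P$ with $i_{Y_1}\cdots i_{Y_{k-p+1}}\omega=0$ for all $Y_j\in V\mathrm{D}$ (zero if $k<p$). Affine $q$-forms are identified with differential forms: $\Omega^q:=\Lambda_{n-1}^{q+n-1}$ (so $\Omega^0$ consists of the horizontal $(n-1)$-forms on $P$); $\delta$ is the restriction of the de Rham differential to $\Omega=\bigoplus_q\Omega^q$. A PD prehamiltonian system on $\alpha$ is an $\omega\in\Omega^2$ with $\delta\omega=0$. If $Y\in V\mathrm{D}$ and $f\in\Omega^0$ satisfy $i_Y\omega=\delta f$, then $Y$ is called a PD Noether symmetry and $f$ a PD Noether current of $\omega$, relative to each other; $\mathscr{S}(\omega)$ and $\mathscr{C}(\omega)$ are the sets of PD Noether symmetries and PD Noether currents. A point $c$ of the first jet bundle $J^1\alpha$ over $y\in P$ is a complement $H_c$ of the vertical space $V_yP$ in $T_yP$; $i_c\omega_y$ is the component of $\omega_y$ of horizontal degree $n$ with respect to $T_yP=V_yP\oplus H_c$.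 A solution of the PD Hamilton equations is a local section $\sigma:U\to P$ of $\alpha$, $U\subset M$ open, with $i_{\dot{\sigma}(x)}\omega_{\sigma(x)}=0$ for all $x\in U$, where $\dot{\sigma}:U\to J^1\alpha$ is the first jet prolongation. In bundle coordinates $(x^i,y^a)$ with $\omega=\omega^i_{ab}dy^ady^bd^{n-1}x_i+\omega_ady^ad^nx$ ($\omega^i_{ab}=-\omega^i_{ba}$, $d^{n-1}x_i=i_{\partial_i}d^nx$) the equations read $2\omega^i_{ab}\partial_iy^a-\omega_b=0$. *)

theory Defs
  imports "HOL-Analysis.Analysis"
begin

section \<open>Smooth maps between open subsets of normed spaces\<close>

text \<open>The model spaces below are finite-dimensional, so that continuity of all iterated directional
  derivatives on an open set is the usual notion of \<open>C\<^sup>k\<close>.\<close>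

primrec Ck_on :: "nat \<Rightarrow> 'a::real_normed_vector set \<Rightarrow> ('a \<Rightarrow> 'b::real_normed_vector) \<Rightarrow> bool" where
  "Ck_on 0 S f \<longleftrightarrow> continuous_on S f"
| "Ck_on (Suc k) S f \<longleftrightarrow>
     (\<forall>x\<in>S. f differentiable (at x)) \<and> (\<forall>v. Ck_on k S (\<lambda>x. frechet_derivative f (at x) v))"

definition smooth_on :: "'a::real_normed_vector set \<Rightarrow> ('a \<Rightarrow> 'b::real_normed_vector) \<Rightarrow> bool" where
  "smooth_on S f \<longleftrightarrow> (\<forall>k. Ck_on k S f)"


section \<open>Manifolds\<close>

type_synonym ('p, 'e) chart = "'p set \<times> ('p \<Rightarrow> 'e)"

definition chart_inv :: "('p, 'e) chart \<Rightarrow> 'e \<Rightarrow> 'p" where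
  "chart_inv c = inv_into (fst c) (snd c)"

record ('p, 'e) mfd =
  mspace :: "'p topology"
  matlas :: "('p, 'e) chart set"

abbreviation mcarrier :: "('p, 'e) mfd \<Rightarrow> 'p set" where
  "mcarrier M \<equiv> topspace (mspace M)"

text \<open>Unlike \<^class>\<open>euclidean_space\<close>, a finite-dimensional normed space may be zero-dimensional;
  this matters for fibers only.\<close>

definition smooth_manifold :: "('p, 'e::real_normed_vector) mfd \<Rightarrow> bool" where
  "smooth_manifold M \<longleftrightarrow>
     (\<exists>B. finite B \<and> span B = (UNIV :: 'e set)) \<and>
     Hausdorff_space (mspace M) \<and> second_countable (mspace M) \<and>
     (\<Union>c\<in>matlas M. fst c) = mcarrier M \<and>
     (\<forall>c\<in>matlas M. openin (mspace M) (fst c) \<and> open (snd c ` fst c) \<and>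
        homeomorphic_map (subtopology (mspace M) (fst c)) (top_of_set (snd c ` fst c)) (snd c)) \<and>
     (\<forall>c\<in>matlas M. \<forall>d\<in>matlas M. smooth_on (snd c ` (fst c \<inter> fst d)) (snd d \<circ> chart_inv c))"

definition mdim :: "('p, 'e::euclidean_space) mfd \<Rightarrow> nat" where
  "mdim M = DIM('e)"

definition prod_mfd :: "('p, 'e) mfd \<Rightarrow> ('q, 'f) mfd \<Rightarrow> ('p \<times> 'q, 'e \<times> 'f) mfd" where
  "prod_mfd M N = \<lparr> mspace = prod_topology (mspace M) (mspace N),
     matlas = {(fst c \<times> fst d, map_prod (snd c) (snd d)) | c d. c \<in> matlas M \<and> d \<in> matlas N} \<rparr>"

definition smooth_map_on ::
  "'p set \<Rightarrow> ('p, 'e::real_normed_vector) mfd \<Rightarrow> ('q, 'f::real_normed_vector) mfd \<Rightarrow> ('p \<Rightarrow> 'q) \<Rightarrow> bool" where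
  "smooth_map_on W M N f \<longleftrightarrow>
     openin (mspace M) W \<and> continuous_map (subtopology (mspace M) W) (mspace N) f \<and>
     (\<forall>c\<in>matlas M. \<forall>d\<in>matlas N.
        smooth_on (snd c ` {p \<in> fst c \<inter> W. f p \<in> fst d}) (snd d \<circ> f \<circ> chart_inv c))"

definition fiber_bundle ::
  "('p, 'g::real_normed_vector) mfd \<Rightarrow> ('m, 'e::real_normed_vector) mfd \<Rightarrow>
   ('q, 'f::real_normed_vector) mfd \<Rightarrow> ('p \<Rightarrow> 'm) \<Rightarrow> bool" where
  "fiber_bundle P M F \<alpha> \<longleftrightarrow>
     smooth_manifold P \<and> smooth_manifold M \<and> smooth_manifold F \<and>
     smooth_map_on (mcarrier P) P M \<alpha> \<and> \<alpha> ` mcarrier P = mcarrier M \<and>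
     (\<forall>x\<in>mcarrier M. \<exists>U T S. x \<in> U \<and> openin (mspace M) U \<and>
        smooth_map_on {p \<in> mcarrier P. \<alpha> p \<in> U} P (prod_mfd M F) T \<and>
        smooth_map_on (U \<times> mcarrier F) (prod_mfd M F) P S \<and>
        (\<forall>p\<in>mcarrier P. \<alpha> p \<in> U \<longrightarrow> fst (T p) = \<alpha> p \<and> S (T p) = p) \<and>
        (\<forall>z\<in>U \<times> mcarrier F. S z \<in> mcarrier P \<and> \<alpha> (S z) \<in> U \<and> T (S z) = z))"


section \<open>Tangent vectors\<close>

text \<open>The tangent space at \<open>p\<close> is the model space: a tangent vector is given by its components
  in one preferred chart around \<open>p\<close>. The preferred chart varies with \<open>p\<close> in an arbitrary way, so
  smoothness of fields and forms is always stated in terms of the components in a fixed chart.\<close>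

definition chart_at :: "('p, 'e) mfd \<Rightarrow> 'p \<Rightarrow> ('p, 'e) chart" where
  "chart_at M p = (SOME c. c \<in> matlas M \<and> p \<in> fst c)"

definition coord_change ::
  "('p, 'e::real_normed_vector) chart \<Rightarrow> ('p, 'e) chart \<Rightarrow> 'p \<Rightarrow> 'e \<Rightarrow> 'e" where
  "coord_change c d p = frechet_derivative (snd d \<circ> chart_inv c) (at (snd c p))"

text \<open>The tangent map of \<open>f\<close> at \<open>p\<close>.\<close>

definition mderiv ::
  "('p, 'e::real_normed_vector) mfd \<Rightarrow> ('q, 'f::real_normed_vector) mfd \<Rightarrow> ('p \<Rightarrow> 'q) \<Rightarrow> 'p \<Rightarrow> 'e \<Rightarrow> 'f" where
  "mderiv M N f p =
     frechet_derivative (snd (chart_at N (f p)) \<circ> f \<circ> chart_inv (chart_at M p)) (at (snd (chart_at M p) p))"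

definition vector_field :: "('p, 'e::real_normed_vector) mfd \<Rightarrow> ('p \<Rightarrow> 'e) \<Rightarrow> bool" where
  "vector_field M Y \<longleftrightarrow>
     (\<forall>c\<in>matlas M. smooth_on (snd c ` fst c)
        (\<lambda>x. let p = chart_inv c x in coord_change (chart_at M p) c p (Y p)))"

definition vertical_space ::
  "('p, 'g::real_normed_vector) mfd \<Rightarrow> ('m, 'e::real_normed_vector) mfd \<Rightarrow> ('p \<Rightarrow> 'm) \<Rightarrow> 'p \<Rightarrow> 'g set" where
  "vertical_space P M \<alpha> y = {v. mderiv P M \<alpha> y v = 0}"

definition vertical_fields ::
  "('p, 'g::real_normed_vector) mfd \<Rightarrow> ('m, 'e::real_normed_vector) mfd \<Rightarrow> ('p \<Rightarrow> 'm) \<Rightarrow> ('p \<Rightarrow> 'g) set" where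
  "vertical_fields P M \<alpha> =
     {Y. vector_field P Y \<and> (\<forall>y\<in>mcarrier P. Y y \<in> vertical_space P M \<alpha> y)}"


section \<open>Differential forms\<close>

text \<open>The arguments of a \<open>k\<close>-form are collected in a list of length \<open>k\<close>; a form vanishes on lists of
  any other length. Hence the interior product of a \<open>0\<close>-form is \<open>0\<close>.\<close>

type_synonym ('p, 'e) dform = "'p \<Rightarrow> 'e list \<Rightarrow> real"

definition alternating :: "nat \<Rightarrow> ('e::real_vector list \<Rightarrow> real) \<Rightarrow> bool" where
  "alternating k \<eta> \<longleftrightarrow>
     (\<forall>vs. length vs \<noteq> k \<longrightarrow> \<eta> vs = 0) \<and>
     (\<forall>vs i. length vs = k \<longrightarrow> i < k \<longrightarrow> linear (\<lambda>v. \<eta> (vs[i := v]))) \<and>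
     (\<forall>vs i j. length vs = k \<longrightarrow> i < k \<longrightarrow> j < k \<longrightarrow> i \<noteq> j \<longrightarrow> vs ! i = vs ! j \<longrightarrow> \<eta> vs = 0)"

text \<open>The local representative of a form in the chart \<open>c\<close>.\<close>

definition chart_rep ::
  "('p, 'e::real_normed_vector) mfd \<Rightarrow> ('p, 'e) chart \<Rightarrow> ('p, 'e) dform \<Rightarrow> ('e, 'e) dform" where
  "chart_rep M c \<eta> x vs =
     (let p = chart_inv c x in \<eta> p (map (coord_change c (chart_at M p) p) vs))"

text \<open>Smooth \<open>k\<close>-forms on an open subset \<open>W\<close>. Values outside \<open>W\<close> are irrelevant, so equality of
  forms is equality at all points of \<open>W\<close>.\<close>

definition form_on ::
  "('p, 'e::real_normed_vector) mfd \<Rightarrow> 'p set \<Rightarrow> nat \<Rightarrow> ('p, 'e) dform \<Rightarrow> bool" where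
  "form_on M W k \<eta> \<longleftrightarrow>
     (\<forall>p\<in>W. alternating k (\<eta> p)) \<and>
     (\<forall>c\<in>matlas M. \<forall>vs. length vs = k \<longrightarrow>
        smooth_on (snd c ` (fst c \<inter> W)) (\<lambda>x. chart_rep M c \<eta> x vs))"

definition forms_eq :: "('p, 'e) mfd \<Rightarrow> 'p set \<Rightarrow> ('p, 'e) dform \<Rightarrow> ('p, 'e) dform \<Rightarrow> bool" where
  "forms_eq M W \<eta> \<theta> \<longleftrightarrow> (\<forall>p\<in>W. \<forall>vs. \<eta> p vs = \<theta> p vs)"

abbreviation zero_form :: "('p, 'e) dform" where
  "zero_form \<equiv> (\<lambda>p vs. 0)"

definition int_prod :: "('p \<Rightarrow> 'e) \<Rightarrow> ('p, 'e) dform \<Rightarrow> ('p, 'e) dform" where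
  "int_prod Y \<eta> p vs = \<eta> p (Y p # vs)"

text \<open>On a normed space,
  \<open>d\<eta>(v\<^sub>0,\<dots>,v\<^sub>k) = \<Sum>\<^sub>i (-1)\<^sup>i D\<^bsub>v\<^sub>i\<^esub> (\<eta>(v\<^sub>0,\<dots>,v\<^sub>i\<^sub>-\<^sub>1,v\<^sub>i\<^sub>+\<^sub>1,\<dots>,v\<^sub>k))\<close>.\<close>

definition ext_deriv_flat :: "('e::real_normed_vector, 'e) dform \<Rightarrow> ('e, 'e) dform" where
  "ext_deriv_flat \<eta> x vs = (\<Sum>i<length vs.
     (-1) ^ i * frechet_derivative (\<lambda>y. \<eta> y (take i vs @ drop (Suc i) vs)) (at x) (vs ! i))"

text \<open>The de Rham differential at \<open>p\<close>, computed in the preferred chart around \<open>p\<close>.\<close>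

definition ext_deriv :: "('p, 'e::real_normed_vector) mfd \<Rightarrow> ('p, 'e) dform \<Rightarrow> ('p, 'e) dform" where
  "ext_deriv M \<eta> p = ext_deriv_flat (chart_rep M (chart_at M p) \<eta>) (snd (chart_at M p) p)"

definition pullback ::
  "('m, 'e::real_normed_vector) mfd \<Rightarrow> ('p, 'g::real_normed_vector) mfd \<Rightarrow> ('m \<Rightarrow> 'p) \<Rightarrow>
   ('p, 'g) dform \<Rightarrow> ('m, 'e) dform" where
  "pullback M P \<sigma> \<eta> x vs = \<eta> (\<sigma> x) (map (mderiv M P \<sigma> x) vs)"

definition closed_form_on ::
  "('p, 'e::real_normed_vector) mfd \<Rightarrow> 'p set \<Rightarrow> nat \<Rightarrow> ('p, 'e) dform \<Rightarrow> bool" where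
  "closed_form_on M W k \<eta> \<longleftrightarrow> form_on M W k \<eta> \<and> forms_eq M W (ext_deriv M \<eta>) zero_form"


section \<open>Affine forms and PD prehamiltonian systems\<close>

definition Lambda ::
  "('p, 'g::real_normed_vector) mfd \<Rightarrow> ('m, 'e::real_normed_vector) mfd \<Rightarrow> ('p \<Rightarrow> 'm) \<Rightarrow>
   nat \<Rightarrow> nat \<Rightarrow> ('p, 'g) dform set" where
  "Lambda P M \<alpha> p k = {\<eta>. form_on P (mcarrier P) k \<eta> \<and>
     (if k < p then forms_eq P (mcarrier P) \<eta> zero_form
      else \<forall>Ys. length Ys = k - p + 1 \<and> set Ys \<subseteq> vertical_fields P M \<alpha> \<longrightarrow>
             forms_eq P (mcarrier P) (foldr int_prod Ys \<eta>) zero_form)}"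

definition Omega ::
  "('p, 'g::real_normed_vector) mfd \<Rightarrow> ('m, 'e::euclidean_space) mfd \<Rightarrow> ('p \<Rightarrow> 'm) \<Rightarrow>
   nat \<Rightarrow> ('p, 'g) dform set" where
  "Omega P M \<alpha> q = Lambda P M \<alpha> (mdim M - 1) (q + mdim M - 1)"

definition PD_prehamiltonian ::
  "('p, 'g::real_normed_vector) mfd \<Rightarrow> ('m, 'e::euclidean_space) mfd \<Rightarrow> ('p \<Rightarrow> 'm) \<Rightarrow>
   ('p, 'g) dform \<Rightarrow> bool" where
  "PD_prehamiltonian P M \<alpha> \<omega> \<longleftrightarrow>
     \<omega> \<in> Omega P M \<alpha> 2 \<and> forms_eq P (mcarrier P) (ext_deriv P \<omega>) zero_form"

definition PD_Noether_pair ::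
  "('p, 'g::real_normed_vector) mfd \<Rightarrow> ('m, 'e::euclidean_space) mfd \<Rightarrow> ('p \<Rightarrow> 'm) \<Rightarrow>
   ('p, 'g) dform \<Rightarrow> ('p \<Rightarrow> 'g) \<Rightarrow> ('p, 'g) dform \<Rightarrow> bool" where
  "PD_Noether_pair P M \<alpha> \<omega> Y f \<longleftrightarrow>
     Y \<in> vertical_fields P M \<alpha> \<and> f \<in> Omega P M \<alpha> 0 \<and>
     forms_eq P (mcarrier P) (int_prod Y \<omega>) (ext_deriv P f)"

definition PD_Noether_symmetries ::
  "('p, 'g::real_normed_vector) mfd \<Rightarrow> ('m, 'e::euclidean_space) mfd \<Rightarrow> ('p \<Rightarrow> 'm) \<Rightarrow>
   ('p, 'g) dform \<Rightarrow> ('p \<Rightarrow> 'g) set" where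
  "PD_Noether_symmetries P M \<alpha> \<omega> = {Y. \<exists>f. PD_Noether_pair P M \<alpha> \<omega> Y f}"

definition PD_Noether_currents ::
  "('p, 'g::real_normed_vector) mfd \<Rightarrow> ('m, 'e::euclidean_space) mfd \<Rightarrow> ('p \<Rightarrow> 'm) \<Rightarrow>
   ('p, 'g) dform \<Rightarrow> ('p, 'g) dform set" where
  "PD_Noether_currents P M \<alpha> \<omega> = {f. \<exists>Y. PD_Noether_pair P M \<alpha> \<omega> Y f}"


section \<open>Jets and the PD Hamilton equations\<close>

definition complement :: "'g::real_vector set \<Rightarrow> 'g set \<Rightarrow> bool" where
  "complement V H \<longleftrightarrow> subspace H \<and> V \<inter> H = {0} \<and> (\<forall>v. \<exists>w\<in>V. \<exists>h\<in>H. v = w + h)"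

text \<open>The point set of the first jet bundle.\<close>

definition jet1 ::
  "('p, 'g::real_normed_vector) mfd \<Rightarrow> ('m, 'e::real_normed_vector) mfd \<Rightarrow> ('p \<Rightarrow> 'm) \<Rightarrow>
   ('p \<times> 'g set) set" where
  "jet1 P M \<alpha> = {(y, H). y \<in> mcarrier P \<and> complement (vertical_space P M \<alpha> y) H}"

definition jet_prolong ::
  "('p, 'g::real_normed_vector) mfd \<Rightarrow> ('m, 'e::real_normed_vector) mfd \<Rightarrow> ('m \<Rightarrow> 'p) \<Rightarrow> 'm \<Rightarrow> 'p \<times> 'g set" where
  "jet_prolong P M \<sigma> x = (\<sigma> x, range (mderiv M P \<sigma> x))"

text \<open>The projection onto \<open>H\<close> along \<open>V\<close>.\<close>

definition proj_along :: "'g::real_vector set \<Rightarrow> 'g set \<Rightarrow> 'g \<Rightarrow> 'g" where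
  "proj_along V H v = (THE h. h \<in> H \<and> v - h \<in> V)"

text \<open>The component of horizontal degree \<open>s\<close> of an alternating form with respect to \<open>V \<oplus> H\<close>:
  decompose every argument into its parts in \<open>V\<close> and \<open>H\<close>, expand multilinearly, and keep the terms
  with exactly \<open>s\<close> arguments in \<open>H\<close> (those with index in \<open>I\<close>).\<close>

definition hor_component ::
  "'g::real_vector set \<Rightarrow> 'g set \<Rightarrow> nat \<Rightarrow> ('g list \<Rightarrow> real) \<Rightarrow> 'g list \<Rightarrow> real" where
  "hor_component V H s \<eta> vs =
     (\<Sum>I | I \<subseteq> {..<length vs} \<and> card I = s.
        \<eta> (map (\<lambda>i. if i \<in> I then proj_along V H (vs ! i) else proj_along H V (vs ! i))
               [0..<length vs]))"

definition jet_contract ::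
  "('p, 'g::real_normed_vector) mfd \<Rightarrow> ('m, 'e::euclidean_space) mfd \<Rightarrow> ('p \<Rightarrow> 'm) \<Rightarrow>
   ('p \<times> 'g set) \<Rightarrow> ('p, 'g) dform \<Rightarrow> 'g list \<Rightarrow> real" where
  "jet_contract P M \<alpha> c \<omega> =
     hor_component (vertical_space P M \<alpha> (fst c)) (snd c) (mdim M) (\<omega> (fst c))"

definition local_section ::
  "('p, 'g::real_normed_vector) mfd \<Rightarrow> ('m, 'e::real_normed_vector) mfd \<Rightarrow> ('p \<Rightarrow> 'm) \<Rightarrow>
   'm set \<Rightarrow> ('m \<Rightarrow> 'p) \<Rightarrow> bool" where
  "local_section P M \<alpha> U \<sigma> \<longleftrightarrow>
     openin (mspace M) U \<and> smooth_map_on U M P \<sigma> \<and> (\<forall>x\<in>U. \<alpha> (\<sigma> x) = x)"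

definition PD_Hamilton_solution ::
  "('p, 'g::real_normed_vector) mfd \<Rightarrow> ('m, 'e::euclidean_space) mfd \<Rightarrow> ('p \<Rightarrow> 'm) \<Rightarrow>
   ('p, 'g) dform \<Rightarrow> 'm set \<Rightarrow> ('m \<Rightarrow> 'p) \<Rightarrow> bool" where
  "PD_Hamilton_solution P M \<alpha> \<omega> U \<sigma> \<longleftrightarrow>
     local_section P M \<alpha> U \<sigma> \<and>
     (\<forall>x\<in>U. \<forall>vs. jet_contract P M \<alpha> (jet_prolong P M \<sigma> x) \<omega> vs = 0)"


section \<open>Jet prolongations of sections lie in the first jet bundle\<close>


lemma smooth_on_differentiable:
  assumes "smooth_on S f" "x \<in> S" shows "f differentiable (at x)"
  using assms(1)[unfolded smooth_on_def, rule_format, of "Suc 0"] assms(2) by simp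

lemma chart_at_in:
  assumes "smooth_manifold M" "p \<in> mcarrier M"
  shows "chart_at M p \<in> matlas M" "p \<in> fst (chart_at M p)"
proof -
  have "\<exists>c. c \<in> matlas M \<and> p \<in> fst c"
    using assms unfolding smooth_manifold_def by blast
  from someI_ex[OF this] show "chart_at M p \<in> matlas M" "p \<in> fst (chart_at M p)"
    unfolding chart_at_def by auto
qed

lemma chart_facts:
  assumes "smooth_manifold M" "c \<in> matlas M"
  shows "openin (mspace M) (fst c)" "open (snd c ` fst c)" "inj_on (snd c) (fst c)"
    "homeomorphic_map (subtopology (mspace M) (fst c)) (top_of_set (snd c ` fst c)) (snd c)"
proof -
  show 1: "openin (mspace M) (fst c)" "open (snd c ` fst c)"
    and h: "homeomorphic_map (subtopology (mspace M) (fst c)) (top_of_set (snd c ` fst c)) (snd c)"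
    using assms unfolding smooth_manifold_def by auto
  have "topspace (subtopology (mspace M) (fst c)) = fst c"
    using openin_subset[OF 1(1)] by auto
  then show "inj_on (snd c) (fst c)"
    using homeomorphic_imp_injective_map[OF h] by simp
qed

lemma chart_inv_chart:
  assumes "smooth_manifold M" "c \<in> matlas M" "p \<in> fst c"
  shows "chart_inv c (snd c p) = p"
  using chart_facts(3)[OF assms(1,2)] assms(3) by (simp add: chart_inv_def)

lemma chart_image_open:
  assumes "smooth_manifold M" "c \<in> matlas M" "openin (mspace M) W" "W \<subseteq> fst c"
  shows "open (snd c ` W)"
proof -
  have "openin (subtopology (mspace M) (fst c)) W"
    using assms(3,4) openin_subset_topspace_eq openin_subtopology by (metis inf.absorb1)
  then have "openin (top_of_set (snd c ` fst c)) (snd c ` W)"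
    using homeomorphic_imp_open_map[OF chart_facts(4)[OF assms(1,2)]] by (auto simp: open_map_def)
  then show ?thesis using chart_facts(2)[OF assms(1,2)] openin_open_trans by blast
qed

lemma mderiv_has_derivative:
  assumes "smooth_manifold M" "smooth_manifold N" "smooth_map_on W M N f" "p \<in> W"
  shows "(snd (chart_at N (f p)) \<circ> f \<circ> chart_inv (chart_at M p) has_derivative mderiv M N f p)
           (at (snd (chart_at M p) p))"
proof -
  have W: "openin (mspace M) W" "continuous_map (subtopology (mspace M) W) (mspace N) f"
    using assms(3) unfolding smooth_map_on_def by auto
  have p: "p \<in> mcarrier M" and fp: "f p \<in> mcarrier N"
    using W assms(4) openin_subset continuous_map_image_subset_topspace by fastforce+
  show ?thesis
    unfolding mderiv_def
    apply (rule frechet_derivative_works[THEN iffD1])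
    apply (rule smooth_on_differentiable[OF assms(3)[unfolded smooth_map_on_def, THEN conjunct2,
          THEN conjunct2, rule_format, OF chart_at_in(1)[OF assms(1) p] chart_at_in(1)[OF assms(2) fp]]])
    using chart_at_in(2)[OF assms(1) p] chart_at_in(2)[OF assms(2) fp] assms(4) by blast
qed

lemma mderiv_section:
  assumes P: "smooth_manifold P" and M: "smooth_manifold M"
    and a: "smooth_map_on (mcarrier P) P M \<alpha>" and s: "local_section P M \<alpha> U \<sigma>" and x: "x \<in> U"
  shows "mderiv P M \<alpha> (\<sigma> x) (mderiv M P \<sigma> x v) = v"
proof -
  have U: "openin (mspace M) U" and sm: "smooth_map_on U M P \<sigma>" and sec: "\<And>x. x \<in> U \<Longrightarrow> \<alpha> (\<sigma> x) = x"
    and cont: "continuous_map (subtopology (mspace M) U) (mspace P) \<sigma>"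
    using s unfolding local_section_def smooth_map_on_def by auto
  have xM: "x \<in> mcarrier M" and sx: "\<sigma> x \<in> mcarrier P"
    using U cont x openin_subset continuous_map_image_subset_topspace by fastforce+
  define c where "c = chart_at M x"
  define d where "d = chart_at P (\<sigma> x)"
  note c = chart_at_in[OF M xM, folded c_def] and d = chart_at_in[OF P sx, folded d_def]
  define N where "N = {p \<in> U \<inter> fst c. \<sigma> p \<in> fst d}"
  have N': "openin (mspace M) {p \<in> U. \<sigma> p \<in> fst d}"
  proof -
    have "openin (subtopology (mspace M) U) {p \<in> topspace (subtopology (mspace M) U). \<sigma> p \<in> fst d}"
      using cont chart_facts(1)[OF P d(1)] by (rule openin_continuous_map_preimage)
    moreover have "topspace (subtopology (mspace M) U) = U" using openin_subset[OF U] by auto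
    ultimately show ?thesis using U openin_trans_full by fastforce
  qed
  have "N = {p \<in> U. \<sigma> p \<in> fst d} \<inter> fst c" by (auto simp: N_def)
  then have "openin (mspace M) N" using N' chart_facts(1)[OF M c(1)] by auto
  then have oN: "open (snd c ` N)" by (rule chart_image_open[OF M c(1)]) (auto simp: N_def)
  have xN: "snd c x \<in> snd c ` N" using x c d by (auto simp: N_def)
  have 1: "(snd d \<circ> \<sigma> \<circ> chart_inv c has_derivative mderiv M P \<sigma> x) (at (snd c x))"
    using mderiv_has_derivative[OF M P sm x] by (simp add: c_def d_def)
  have 2: "(snd c \<circ> \<alpha> \<circ> chart_inv d has_derivative mderiv P M \<alpha> (\<sigma> x)) (at (snd d (\<sigma> x)))"
    using mderiv_has_derivative[OF P M a sx] sec[OF x] by (simp add: c_def d_def)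
  have e: "(snd d \<circ> \<sigma> \<circ> chart_inv c) (snd c x) = snd d (\<sigma> x)"
    using chart_inv_chart[OF M c] by simp
  have 3: "((snd c \<circ> \<alpha> \<circ> chart_inv d) \<circ> (snd d \<circ> \<sigma> \<circ> chart_inv c) has_derivative
         mderiv P M \<alpha> (\<sigma> x) \<circ> mderiv M P \<sigma> x) (at (snd c x))"
    by (rule diff_chain_at[OF 1]) (use 2 e in simp)
  have "((\<lambda>z. z) has_derivative mderiv P M \<alpha> (\<sigma> x) \<circ> mderiv M P \<sigma> x) (at (snd c x))"
    apply (rule has_derivative_transform_within_open[OF 3 oN xN])
    using chart_inv_chart[OF M c(1)] chart_inv_chart[OF P d(1)] sec by (auto simp: N_def)
  then have "mderiv P M \<alpha> (\<sigma> x) \<circ> mderiv M P \<sigma> x = (\<lambda>z. z)"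
    using has_derivative_unique has_derivative_ident by blast
  then show ?thesis by (metis comp_apply)
qed

lemma jet_prolong_in_jet1:
  assumes "fiber_bundle P M F \<alpha>" "local_section P M \<alpha> U \<sigma>" "x \<in> U"
  shows "jet_prolong P M \<sigma> x \<in> jet1 P M \<alpha>"
proof -
  have P: "smooth_manifold P" and M: "smooth_manifold M" and a: "smooth_map_on (mcarrier P) P M \<alpha>"
    using assms(1) unfolding fiber_bundle_def by auto
  have sm: "smooth_map_on U M P \<sigma>"
    using assms(2) unfolding local_section_def by auto
  have sx: "\<sigma> x \<in> mcarrier P"
    using sm assms(3) openin_subset continuous_map_image_subset_topspace
    unfolding smooth_map_on_def by fastforce
  note l = mderiv_section[OF P M a assms(2,3)]
  have ls: "linear (mderiv M P \<sigma> x)" and la: "linear (mderiv P M \<alpha> (\<sigma> x))"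
    using mderiv_has_derivative[OF M P sm assms(3)] mderiv_has_derivative[OF P M a sx]
      has_derivative_linear by blast+
  have "complement (vertical_space P M \<alpha> (\<sigma> x)) (range (mderiv M P \<sigma> x))"
    unfolding complement_def
  proof (intro conjI allI)
    show "subspace (range (mderiv M P \<sigma> x))" using ls linear_subspace_image subspace_UNIV by blast
    show "vertical_space P M \<alpha> (\<sigma> x) \<inter> range (mderiv M P \<sigma> x) = {0}"
      using l linear_0[OF ls] linear_0[OF la] by (fastforce simp: vertical_space_def)
    fix v
    let ?h = "mderiv M P \<sigma> x (mderiv P M \<alpha> (\<sigma> x) v)"
    have "v - ?h \<in> vertical_space P M \<alpha> (\<sigma> x)"
      by (simp add: vertical_space_def linear_diff[OF la] l)
    moreover have "v = (v - ?h) + ?h" by simp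
    ultimately show "\<exists>w\<in>vertical_space P M \<alpha> (\<sigma> x). \<exists>h\<in>range (mderiv M P \<sigma> x). v = w + h"
      by blast
  qed
  then show ?thesis using sx by (simp add: jet1_def jet_prolong_def)
qed

end

theory Submission
  imports Defs
begin

text \<open>Let \<open>\<sigma>\<close> be a solution and let \<open>v\<^sub>1,\<dots>,v\<^sub>n\<close> be tangent vectors at a point of its domain. The exterior
  derivative commutes with pullback (\<open>ext_deriv_pullback\<close>), so the Noether relation gives
  \<open>d(\<sigma>\<^sup>*f)(v\<^sub>1,\<dots>,v\<^sub>n) = df(T\<sigma> v\<^sub>1,\<dots>,T\<sigma> v\<^sub>n) = \<omega>(Y, T\<sigma> v\<^sub>1,\<dots>,T\<sigma> v\<^sub>n)\<close>.
  Here \<open>Y\<close> is vertical and the other arguments lie in the image of \<open>T\<sigma>\<close>, which is the complement that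
  the jet of \<open>\<sigma>\<close> selects. When the component of \<open>\<omega>\<close> of horizontal degree \<open>n\<close> is evaluated on these
  arguments, only the summand that keeps \<open>Y\<close> vertical survives, and it is \<open>\<omega>(Y, T\<sigma> v\<^sub>1,\<dots>,T\<sigma> v\<^sub>n)\<close>
  itself (\<open>hor_component_vertical_head\<close>). The PD Hamilton equations say that this component is zero.

  The substance is therefore that \<open>d\<close> commutes with pullback. On open subsets of Euclidean spaces
  (\<open>ext_deriv_flat_pullback\<close>), differentiating \<open>\<eta>(\<phi> x)(D\<phi>(x) w\<^sub>1,\<dots>,D\<phi>(x) w\<^sub>k)\<close> by the product
  rule gives the desired term and further terms in which one argument is a value of the second
  derivative of \<open>\<phi>\<close>. The latter is symmetric, so these terms cancel in pairs in the alternating sum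
  that defines \<open>d\<close>. On manifolds a form is given at each point in a chart preferred by that point;
  the chain rule (\<open>mderiv_coord_change\<close>) turns its pullback, read in a fixed chart, into a pullback
  between Euclidean spaces.\<close>

section \<open>Calculus of smooth maps\<close>

lemma Ck_on_cong:
  assumes "open S" "\<And>x. x \<in> S \<Longrightarrow> f x = g x" "Ck_on k S f"
  shows "Ck_on k S g"
  using assms(2,3)
proof (induction k arbitrary: f g)
  case 0
  then show ?case using continuous_on_cong by force
next
  case (Suc k)
  have "frechet_derivative f (at x) = frechet_derivative g (at x)" if "x \<in> S" for x
    using Suc.prems assms(1) that by (intro frechet_derivative_transform_within_open) auto
  moreover have "g differentiable (at x)" if "x \<in> S" for x
    using Suc.prems assms(1) that unfolding differentiable_def Ck_on.simps
    by (meson has_derivative_transform_within_open)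
  ultimately show ?case
    using Suc.prems(2) Suc.IH[of "\<lambda>x. frechet_derivative f (at x) v"
        "\<lambda>x. frechet_derivative g (at x) v" for v]
    by simp
qed

lemma Ck_on_Suc_imp: "Ck_on (Suc k) S f \<Longrightarrow> Ck_on k S f"
proof (induction k arbitrary: f)
  case 0
  then show ?case
    by (auto intro!: continuous_at_imp_continuous_on differentiable_imp_continuous_within)
next
  case (Suc k)
  show ?case unfolding Ck_on.simps(2)[of k]
    using Suc.prems Suc.IH unfolding Ck_on.simps(2)[of "Suc k"] by blast
qed

lemma Ck_on_local:
  assumes "\<And>x. x \<in> S \<Longrightarrow> \<exists>T. open T \<and> x \<in> T \<and> Ck_on k T f"
  shows "Ck_on k S f"
  using assms
proof (induction k arbitrary: f)
  case 0
  then have "continuous (at x) f" if "x \<in> S" for x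
    using that by (metis Ck_on.simps(1) continuous_on_eq_continuous_at)
  then show ?case by (simp add: continuous_at_imp_continuous_on)
next
  case (Suc k)
  then show ?case by (metis Ck_on.simps(2))
qed

lemma smooth_on_local:
  assumes "\<And>x. x \<in> S \<Longrightarrow> \<exists>T. open T \<and> x \<in> T \<and> smooth_on T f"
  shows "smooth_on S f"
  using assms Ck_on_local unfolding smooth_on_def by metis

lemma smooth_on_cong:
  "open S \<Longrightarrow> (\<And>x. x \<in> S \<Longrightarrow> f x = g x) \<Longrightarrow> smooth_on S f \<Longrightarrow> smooth_on S g"
  using Ck_on_cong unfolding smooth_on_def by metis

lemma smooth_on_frechet_derivative:
  "smooth_on S f \<Longrightarrow> smooth_on S (\<lambda>x. frechet_derivative f (at x) v)"
  unfolding smooth_on_def by (metis Ck_on.simps(2))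

lemma Ck_on_const: "Ck_on k S (\<lambda>x. c)"
  by (induction k arbitrary: c) auto

lemma has_frechet_derivative:
  "f differentiable (at x) \<Longrightarrow> (f has_derivative frechet_derivative f (at x)) (at x)"
  using frechet_derivative_works by blast

lemma Ck_on_add:
  assumes "open S" "Ck_on k S f" "Ck_on k S g"
  shows "Ck_on k S (\<lambda>x. f x + g x)"
  using assms(2,3)
proof (induction k arbitrary: f g)
  case 0
  then show ?case by (auto intro: continuous_intros)
next
  case (Suc k)
  have e: "((\<lambda>x. f x + g x) has_derivative
      (\<lambda>v. frechet_derivative f (at x) v + frechet_derivative g (at x) v)) (at x)" if "x \<in> S" for x
    using Suc.prems that by (intro has_derivative_add has_frechet_derivative) auto
  note d = frechet_derivative_at[OF e, symmetric]
  show ?case unfolding Ck_on.simps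
  proof (intro conjI ballI allI)
    show "(\<lambda>x. f x + g x) differentiable at x" if "x \<in> S" for x
      using e[OF that] unfolding differentiable_def by blast
    show "Ck_on k S (\<lambda>x. frechet_derivative (\<lambda>x. f x + g x) (at x) v)" for v
      by (rule Ck_on_cong[OF assms(1) _ Suc.IH]) (use d Suc.prems in auto)
  qed
qed

lemma Ck_on_scaleR:
  assumes "open S" "Ck_on k S f" "Ck_on k S g"
  shows "Ck_on k S (\<lambda>x. f x *\<^sub>R g x)"
  using assms(2,3)
proof (induction k arbitrary: f g)
  case 0
  then show ?case by (auto intro: continuous_intros)
next
  case (Suc k)
  have e: "((\<lambda>x. f x *\<^sub>R g x) has_derivative
      (\<lambda>v. f x *\<^sub>R frechet_derivative g (at x) v + frechet_derivative f (at x) v *\<^sub>R g x)) (at x)"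
    if "x \<in> S" for x
    using Suc.prems that by (intro has_derivative_scaleR has_frechet_derivative) auto
  note d = frechet_derivative_at[OF e, symmetric]
  have fg: "Ck_on k S f" "Ck_on k S g"
    using Suc.prems Ck_on_Suc_imp by blast+
  show ?case unfolding Ck_on.simps
  proof (intro conjI ballI allI)
    show "(\<lambda>x. f x *\<^sub>R g x) differentiable at x" if "x \<in> S" for x
      using e[OF that] unfolding differentiable_def by blast
    show "Ck_on k S (\<lambda>x. frechet_derivative (\<lambda>x. f x *\<^sub>R g x) (at x) v)" for v
      by (rule Ck_on_cong[OF assms(1) _ Ck_on_add[OF assms(1) Suc.IH[of f "\<lambda>x. frechet_derivative g (at x) v"]
              Suc.IH[of "\<lambda>x. frechet_derivative f (at x) v" g]]])
        (use d Suc.prems fg in auto)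
  qed
qed

lemma Ck_on_sum:
  assumes "open S" "\<And>i. i \<in> I \<Longrightarrow> Ck_on k S (f i)"
  shows "Ck_on k S (\<lambda>x. \<Sum>i\<in>I. f i x)"
proof (cases "finite I")
  case True
  then show ?thesis using assms(2)
    by (induction I) (auto simp: Ck_on_const intro: Ck_on_add[OF assms(1)])
qed (simp add: Ck_on_const)

lemma Ck_on_inner_left:
  assumes "open S" "Ck_on k S f"
  shows "Ck_on k S (\<lambda>x. f x \<bullet> b)"
  using assms(2)
proof (induction k arbitrary: f)
  case 0
  then show ?case by (auto intro: continuous_intros)
next
  case (Suc k)
  have e: "((\<lambda>x. f x \<bullet> b) has_derivative (\<lambda>v. frechet_derivative f (at x) v \<bullet> b)) (at x)"
    if "x \<in> S" for x
    using Suc.prems that by (intro has_derivative_inner_left has_frechet_derivative) auto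
  note d = frechet_derivative_at[OF e, symmetric]
  show ?case unfolding Ck_on.simps
  proof (intro conjI ballI allI)
    show "(\<lambda>x. f x \<bullet> b) differentiable at x" if "x \<in> S" for x
      using e[OF that] unfolding differentiable_def by blast
    show "Ck_on k S (\<lambda>x. frechet_derivative (\<lambda>x. f x \<bullet> b) (at x) v)" for v
      by (rule Ck_on_cong[OF assms(1) _ Suc.IH]) (use d Suc.prems in auto)
  qed
qed

lemma linear_basis_expand:
  fixes v :: "'a::euclidean_space"
  assumes "linear L"
  shows "L v = (\<Sum>b\<in>Basis. (v \<bullet> b) *\<^sub>R L b)"
  by (metis (no_types, lifting) assms euclidean_representation linear_scale linear_sum sum.cong)

text \<open>By induction on \<open>k\<close>: the chain rule, with the outer derivative expanded in a basis, writes the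
  derivative of the composition as a sum of products of maps of class \<open>C\<^sup>k\<close>. Expanding in a basis
  keeps the direction of differentiation of \<open>f\<close> constant, as the definition of \<open>Ck_on\<close> demands.\<close>

lemma Ck_on_compose:
  fixes g :: "'a::real_normed_vector \<Rightarrow> 'b::euclidean_space"
    and f :: "'b \<Rightarrow> 'c::real_normed_vector"
  assumes "open S" "Ck_on k S g" "Ck_on k T f" "g ` S \<subseteq> T"
  shows "Ck_on k S (\<lambda>x. f (g x))"
  using assms(2-)
proof (induction k arbitrary: f)
  case 0
  then show ?case using continuous_on_compose2 by auto
next
  case (Suc k)
  let ?D = "\<lambda>x v. \<Sum>b\<in>Basis. (frechet_derivative g (at x) v \<bullet> b) *\<^sub>R frechet_derivative f (at (g x)) b"
  have e: "((\<lambda>x. f (g x)) has_derivative ?D x) (at x)" if "x \<in> S" for x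
  proof -
    have fd: "(f has_derivative frechet_derivative f (at (g x))) (at (g x))"
      using Suc.prems that by (intro has_frechet_derivative) auto
    have "(g has_derivative frechet_derivative g (at x)) (at x)"
      using Suc.prems that by (intro has_frechet_derivative) auto
    from diff_chain_at[OF this fd] show ?thesis
      unfolding o_def linear_basis_expand[OF has_derivative_linear[OF fd],
          of "frechet_derivative g (at x) v" for v] .
  qed
  note d = frechet_derivative_at[OF e, symmetric]
  show ?case unfolding Ck_on.simps
  proof (intro conjI ballI allI)
    show "(\<lambda>x. f (g x)) differentiable at x" if "x \<in> S" for x
      using e[OF that] unfolding differentiable_def by blast
    have "Ck_on k S (\<lambda>x. ?D x v)" for v
    proof (intro Ck_on_sum Ck_on_scaleR Ck_on_inner_left assms(1))
      show "Ck_on k S (\<lambda>x. frechet_derivative g (at x) v)" using Suc.prems(1) by simp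
      show "Ck_on k S (\<lambda>x. frechet_derivative f (at (g x)) b)" for b
        using Suc.prems by (intro Suc.IH Ck_on_Suc_imp[OF Suc.prems(1)]) auto
    qed
    then show "Ck_on k S (\<lambda>x. frechet_derivative (\<lambda>x. f (g x)) (at x) v)" for v
      by (rule Ck_on_cong[OF assms(1), rotated]) (use d in auto)
  qed
qed

lemma smooth_on_compose:
  fixes g :: "'a::real_normed_vector \<Rightarrow> 'b::euclidean_space"
  assumes "open S" "smooth_on S g" "smooth_on T f" "g ` S \<subseteq> T"
  shows "smooth_on S (\<lambda>x. f (g x))"
  using assms Ck_on_compose unfolding smooth_on_def by blast

section \<open>Symmetry of second derivatives\<close>

lemma has_derivative_along_line:
  assumes "f differentiable (at (x + s *\<^sub>R u))"
  shows "((\<lambda>s. f (x + s *\<^sub>R u)) has_derivative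
           (\<lambda>h. h *\<^sub>R frechet_derivative f (at (x + s *\<^sub>R u)) u)) (at s)"
proof -
  have l: "((\<lambda>s. x + s *\<^sub>R u) has_derivative (\<lambda>h. h *\<^sub>R u)) (at s)"
    by (auto intro!: derivative_eq_intros)
  have f: "(f has_derivative frechet_derivative f (at (x + s *\<^sub>R u))) (at (x + s *\<^sub>R u))"
    using assms by (rule has_frechet_derivative)
  show ?thesis
    using diff_chain_at[OF l f] linear_scale[OF has_derivative_linear[OF f]] by (simp add: o_def)
qed

text \<open>The second difference of \<open>f\<close> over a parallelogram is symmetric in its sides \<open>u\<close> and \<open>v\<close>. Two
  applications of the mean value theorem equate it to \<open>h\<^sup>2\<close> times a mixed second derivative at some
  point of the parallelogram, and the order of differentiation may be chosen either way.\<close>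

lemma second_difference_mvt:
  fixes f :: "'a::real_normed_vector \<Rightarrow> real"
  assumes "0 < h" and box: "\<And>s t. \<lbrakk>0 \<le> s; s \<le> h; 0 \<le> t; t \<le> h\<rbrakk> \<Longrightarrow> x + s *\<^sub>R u + t *\<^sub>R v \<in> S"
    and C2: "Ck_on 2 S f"
  shows "\<exists>s t. 0 \<le> s \<and> s \<le> h \<and> 0 \<le> t \<and> t \<le> h \<and>
    f (x + h *\<^sub>R u + h *\<^sub>R v) - f (x + h *\<^sub>R u) - f (x + h *\<^sub>R v) + f x =
    h * h * frechet_derivative (\<lambda>z. frechet_derivative f (at z) u) (at (x + s *\<^sub>R u + t *\<^sub>R v)) v"
proof -
  define g where "g = (\<lambda>z. frechet_derivative f (at z) u)"
  have df: "f differentiable (at z)" and dg: "g differentiable (at z)" if "z \<in> S" for z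
    using C2 that by (simp_all add: numeral_2_eq_2 g_def)
  let ?p = "\<lambda>s. f (x + h *\<^sub>R v + s *\<^sub>R u) - f (x + s *\<^sub>R u)"
  have 1: "(?p has_derivative (\<lambda>r. r *\<^sub>R g (x + h *\<^sub>R v + s *\<^sub>R u) - r *\<^sub>R g (x + s *\<^sub>R u)))
      (at s)" if "0 \<le> s" "s \<le> h" for s
    unfolding g_def using box[of s h] box[of s 0] that \<open>0 < h\<close>
    by (intro has_derivative_diff has_derivative_along_line df) (simp_all add: algebra_simps)
  obtain s where s: "0 < s" "s < h"
      "?p h - ?p 0 = h *\<^sub>R g (x + h *\<^sub>R v + s *\<^sub>R u) - h *\<^sub>R g (x + s *\<^sub>R u)"
    using mvt_simple[OF \<open>0 < h\<close>, of ?p "\<lambda>s r. r *\<^sub>R g (x + h *\<^sub>R v + s *\<^sub>R u) - r *\<^sub>R g (x + s *\<^sub>R u)",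
        OF has_derivative_at_withinI[OF 1]] by auto
  have 2: "((\<lambda>t. g (x + s *\<^sub>R u + t *\<^sub>R v)) has_derivative
      (\<lambda>r. r *\<^sub>R frechet_derivative g (at (x + s *\<^sub>R u + t *\<^sub>R v)) v)) (at t)"
    if "0 \<le> t" "t \<le> h" for t
    using box[of s t] s that by (intro has_derivative_along_line dg) auto
  obtain t where t: "0 < t" "t < h" "g (x + s *\<^sub>R u + h *\<^sub>R v) - g (x + s *\<^sub>R u) =
      h * frechet_derivative g (at (x + s *\<^sub>R u + t *\<^sub>R v)) v"
    using mvt_simple[OF \<open>0 < h\<close>, of "\<lambda>t. g (x + s *\<^sub>R u + t *\<^sub>R v)"
        "\<lambda>t r. r *\<^sub>R frechet_derivative g (at (x + s *\<^sub>R u + t *\<^sub>R v)) v",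
        OF has_derivative_at_withinI[OF 2]] by auto
  have "f (x + h *\<^sub>R u + h *\<^sub>R v) - f (x + h *\<^sub>R u) - f (x + h *\<^sub>R v) + f x = ?p h - ?p 0"
    by (simp add: algebra_simps)
  also have "\<dots> = h * (g (x + s *\<^sub>R u + h *\<^sub>R v) - g (x + s *\<^sub>R u))"
    unfolding s(3) by (simp add: algebra_simps)
  finally show ?thesis
    unfolding t(3) using s t by (intro exI[of _ s] exI[of _ t]) (auto simp: g_def)
qed

text \<open>Both mixed derivatives, at suitable points of arbitrarily small parallelograms with corner \<open>x\<close>,
  equal the same second difference divided by \<open>h\<^sup>2\<close>; continuity carries the equality over to \<open>x\<close>.\<close>

lemma second_derivative_symmetric_real:
  fixes f :: "'a::real_normed_vector \<Rightarrow> real"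
  assumes "open S" "x \<in> S" and C2: "Ck_on 2 S f"
  shows "frechet_derivative (\<lambda>z. frechet_derivative f (at z) u) (at x) v =
         frechet_derivative (\<lambda>z. frechet_derivative f (at z) v) (at x) u"
proof -
  define D where "D u v z = frechet_derivative (\<lambda>z. frechet_derivative f (at z) u) (at z) v" for u v z
  have cont: "isCont (D u v) x" for u v
    using C2 assms(1,2) by (simp add: numeral_2_eq_2 D_def[abs_def] continuous_on_eq_continuous_at)
  have "dist (D u v x) (D v u x) \<le> e" if "e > 0" for e
  proof -
    obtain d1 where d1: "d1 > 0" "\<And>z. dist z x < d1 \<Longrightarrow> dist (D u v z) (D u v x) < e / 2"
      using cont[of u v] \<open>e > 0\<close> unfolding continuous_at_eps_delta
      by (metis dist_norm half_gt_zero)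
    obtain d2 where d2: "d2 > 0" "\<And>z. dist z x < d2 \<Longrightarrow> dist (D v u z) (D v u x) < e / 2"
      using cont[of v u] \<open>e > 0\<close> unfolding continuous_at_eps_delta
      by (metis dist_norm half_gt_zero)
    obtain d3 where d3: "d3 > 0" "\<And>z. dist z x < d3 \<Longrightarrow> z \<in> S"
      using assms(1,2) unfolding open_dist by blast
    define d where "d = min d1 (min d2 d3)"
    \<comment> \<open>the parallelogram with sides \<open>h u\<close> and \<open>h v\<close> fits into the ball of radius \<open>d\<close>\<close>
    define h where "h = d / (2 * (norm u + norm v + 1))"
    have d: "d > 0" using d1 d2 d3 by (simp add: d_def)
    have "0 < 2 * (norm u + norm v + 1)" by (smt (verit) norm_ge_zero)
    then have h: "h > 0" using d by (simp add: h_def)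
    have near: "dist (x + s *\<^sub>R a + t *\<^sub>R b) x < d"
      if "0 \<le> s" "s \<le> h" "0 \<le> t" "t \<le> h" "norm a + norm b = norm u + norm v" for s t a b
    proof -
      have "dist (x + s *\<^sub>R a + t *\<^sub>R b) x \<le> s * norm a + t * norm b"
        using norm_triangle_ineq[of "s *\<^sub>R a" "t *\<^sub>R b"] that by (simp add: dist_norm add.assoc)
      also have "\<dots> \<le> h * norm a + h * norm b"
        using that by (intro add_mono mult_right_mono) auto
      also have "\<dots> = h * (norm u + norm v)" using that(5) by (metis distrib_left)
      also have "\<dots> < h * (2 * (norm u + norm v + 1))"
        using h by (intro mult_strict_left_mono) (smt (verit) norm_ge_zero)+
      also have "\<dots> = d" using \<open>0 < 2 * (norm u + norm v + 1)\<close> by (simp add: h_def)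
      finally show ?thesis .
    qed
    obtain s t where st: "0 \<le> s" "s \<le> h" "0 \<le> t" "t \<le> h"
      "f (x + h *\<^sub>R u + h *\<^sub>R v) - f (x + h *\<^sub>R u) - f (x + h *\<^sub>R v) + f x =
       h * h * D u v (x + s *\<^sub>R u + t *\<^sub>R v)"
      using second_difference_mvt[OF h _ C2, of x u v] near d3(2) by (force simp: D_def d_def)
    obtain s' t' where st': "0 \<le> s'" "s' \<le> h" "0 \<le> t'" "t' \<le> h"
      "f (x + h *\<^sub>R v + h *\<^sub>R u) - f (x + h *\<^sub>R v) - f (x + h *\<^sub>R u) + f x =
       h * h * D v u (x + s' *\<^sub>R v + t' *\<^sub>R u)"
      using second_difference_mvt[OF h _ C2, of x v u] near d3(2) by (force simp: D_def d_def)
    have "h * h * D u v (x + s *\<^sub>R u + t *\<^sub>R v) = h * h * D v u (x + s' *\<^sub>R v + t' *\<^sub>R u)"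
      unfolding st(5)[symmetric] st'(5)[symmetric] by (simp add: algebra_simps)
    then have "D u v (x + s *\<^sub>R u + t *\<^sub>R v) = D v u (x + s' *\<^sub>R v + t' *\<^sub>R u)"
      using h by simp
    moreover have "dist (D u v (x + s *\<^sub>R u + t *\<^sub>R v)) (D u v x) < e / 2"
      using near[of s t u v] st by (intro d1(2)) (auto simp: d_def)
    moreover have "dist (D v u (x + s' *\<^sub>R v + t' *\<^sub>R u)) (D v u x) < e / 2"
      using near[of s' t' v u] st' by (intro d2(2)) (auto simp: d_def)
    ultimately show ?thesis
      using dist_triangle_half_r[of "D u v (x + s *\<^sub>R u + t *\<^sub>R v)"] by (simp add: less_imp_le)
  qed
  then have "D u v x = D v u x"
    using field_le_epsilon[of "dist (D u v x) (D v u x)" 0] by simp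
  then show ?thesis by (simp add: D_def)
qed

lemma second_derivative_symmetric:
  fixes f :: "'a::real_normed_vector \<Rightarrow> 'b::euclidean_space"
  assumes "open S" "x \<in> S" and C2: "Ck_on 2 S f"
  shows "frechet_derivative (\<lambda>z. frechet_derivative f (at z) u) (at x) v =
         frechet_derivative (\<lambda>z. frechet_derivative f (at z) v) (at x) u"
proof (rule euclidean_eqI)
  fix b :: 'b assume "b \<in> Basis"
  have d1: "f differentiable (at z)" "(\<lambda>z. frechet_derivative f (at z) w) differentiable (at z)"
    if "z \<in> S" for z w using C2 that by (auto simp: numeral_2_eq_2)
  have 1: "frechet_derivative (\<lambda>y. f y \<bullet> b) (at z) w = frechet_derivative f (at z) w \<bullet> b"
    if "z \<in> S" for z w
    using frechet_derivative_at[OF has_derivative_inner_left[OF has_frechet_derivative[OF d1(1)[OF that]]]]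
    by metis
  have 2: "frechet_derivative (\<lambda>z. frechet_derivative (\<lambda>y. f y \<bullet> b) (at z) w) (at x) w' =
      frechet_derivative (\<lambda>z. frechet_derivative f (at z) w) (at x) w' \<bullet> b" for w w'
  proof -
    have "((\<lambda>z. frechet_derivative f (at z) w \<bullet> b) has_derivative
        (\<lambda>w'. frechet_derivative (\<lambda>z. frechet_derivative f (at z) w) (at x) w' \<bullet> b)) (at x)"
      by (intro has_derivative_inner_left has_frechet_derivative d1 assms)
    then have "((\<lambda>z. frechet_derivative (\<lambda>y. f y \<bullet> b) (at z) w) has_derivative
        (\<lambda>w'. frechet_derivative (\<lambda>z. frechet_derivative f (at z) w) (at x) w' \<bullet> b)) (at x)"
      by (rule has_derivative_transform_within_open[OF _ assms(1,2)]) (simp add: 1)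
    then show ?thesis by (metis frechet_derivative_at)
  qed
  show "frechet_derivative (\<lambda>z. frechet_derivative f (at z) u) (at x) v \<bullet> b =
         frechet_derivative (\<lambda>z. frechet_derivative f (at z) v) (at x) u \<bullet> b"
    unfolding 2[symmetric]
    by (rule second_derivative_symmetric_real[OF assms(1,2) Ck_on_inner_left[OF assms(1) C2]])
qed

section \<open>Multilinear and alternating forms\<close>

text \<open>Arguments are addressed by splitting the list, rather than by an index as in \<open>alternating\<close>:
  this form passes to \<open>\<lambda>vs. \<eta> (b # vs)\<close>, and so supports induction on the argument list.\<close>

definition multilinear_form :: "nat \<Rightarrow> ('a::real_vector list \<Rightarrow> real) \<Rightarrow> bool" where
  "multilinear_form k \<eta> \<longleftrightarrow>
     (\<forall>us vs. Suc (length us + length vs) = k \<longrightarrow> linear (\<lambda>v. \<eta> (us @ v # vs)))"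

lemma multilinear_formD:
  "multilinear_form k \<eta> \<Longrightarrow> Suc (length us + length vs) = k \<Longrightarrow> linear (\<lambda>v. \<eta> (us @ v # vs))"
  by (auto simp: multilinear_form_def)

lemma multilinear_form_Cons:
  assumes "multilinear_form (Suc k) \<eta>"
  shows "multilinear_form k (\<lambda>vs. \<eta> (b # vs))"
  unfolding multilinear_form_def using multilinear_formD[OF assms, of "b # us" for us] by auto

lemma multilinear_form_head:
  "multilinear_form (Suc k) \<eta> \<Longrightarrow> length vs = k \<Longrightarrow> linear (\<lambda>v. \<eta> (v # vs))"
  using multilinear_formD[of "Suc k" \<eta> "[]" vs] by simp

lemma multilinear_form_expand:
  fixes v :: "'a::euclidean_space"
  assumes "multilinear_form (Suc k) \<eta>" "length vs = k"
  shows "\<eta> (v # vs) = (\<Sum>b\<in>Basis. (v \<bullet> b) *\<^sub>R \<eta> (b # vs))"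
  by (rule linear_basis_expand[OF multilinear_form_head[OF assms]])

lemma alternating_multilinear:
  assumes "alternating k \<eta>"
  shows "multilinear_form k \<eta>"
  unfolding multilinear_form_def
proof (intro allI impI)
  fix us vs :: "'a list"
  assume k: "Suc (length us + length vs) = k"
  have "linear (\<lambda>v. \<eta> ((us @ 0 # vs)[length us := v]))"
    using assms[unfolded alternating_def, THEN conjunct2, THEN conjunct1, rule_format,
        of "us @ 0 # vs" "length us"] k by simp
  then show "linear (\<lambda>v. \<eta> (us @ v # vs))" by simp
qed

lemma alternating_equal_adjacent:
  assumes "alternating k \<eta>"
  shows "\<eta> (us @ v # v # vs) = 0"
proof (cases "length (us @ v # v # vs) = k")
  case True
  have "(us @ v # v # vs) ! length us = (us @ v # v # vs) ! Suc (length us)"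
    by (simp add: nth_append)
  then show ?thesis
    using assms True unfolding alternating_def
    by (metis length_append length_Cons add_Suc_right less_add_Suc1 n_not_Suc_n Suc_less_eq)
qed (use assms in \<open>auto simp: alternating_def\<close>)

text \<open>Polarization: expand the value on two equal adjacent arguments \<open>v + w\<close>.\<close>

lemma alternating_swap_adjacent:
  assumes "alternating k \<eta>"
  shows "\<eta> (us @ v # w # vs) = - \<eta> (us @ w # v # vs)"
proof (cases "Suc (Suc (length us + length vs)) = k")
  case True
  have l1: "linear (\<lambda>v. \<eta> (us @ v # x # vs))" for x
    using multilinear_formD[OF alternating_multilinear[OF assms], of us "x # vs"] True by simp
  have l2: "linear (\<lambda>v. \<eta> (us @ x # v # vs))" for x
    using multilinear_formD[OF alternating_multilinear[OF assms], of "us @ [x]" vs] True by simp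
  have "0 = \<eta> (us @ (v + w) # (v + w) # vs)"
    using alternating_equal_adjacent[OF assms] by simp
  also have "\<dots> = \<eta> (us @ v # v # vs) + \<eta> (us @ v # w # vs) +
      (\<eta> (us @ w # v # vs) + \<eta> (us @ w # w # vs))"
    unfolding linear_add[OF l1] linear_add[OF l2] by simp
  also have "\<dots> = \<eta> (us @ v # w # vs) + \<eta> (us @ w # v # vs)"
    using alternating_equal_adjacent[OF assms] by simp
  finally show ?thesis by simp
qed (use assms in \<open>auto simp: alternating_def\<close>)

lemma alternating_move:
  assumes "alternating k \<eta>"
  shows "\<eta> (us @ v # ws @ vs) = (-1) ^ length ws * \<eta> (us @ ws @ v # vs)"
proof (induction ws arbitrary: us)
  case (Cons w ws)
  then show ?case
    using alternating_swap_adjacent[OF assms, of us v w "ws @ vs"] Cons.IH[of "us @ [w]"] by simp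
qed simp

lemma split_at_two:
  assumes "i < j" "j < length vs"
  obtains xs a ys b zs where "vs = xs @ a # ys @ b # zs" "length xs = i" "i + Suc (length ys) = j"
proof
  have "vs = take i vs @ vs ! i # drop (Suc i) vs"
    using assms by (simp add: id_take_nth_drop)
  moreover have "drop (Suc i) vs = take (j - Suc i) (drop (Suc i) vs) @ vs ! j # drop (Suc j) vs"
    using assms id_take_nth_drop[of "j - Suc i" "drop (Suc i) vs"] by simp
  ultimately show "vs = take i vs @ vs ! i # take (j - Suc i) (drop (Suc i) vs) @ vs ! j # drop (Suc j) vs"
    by metis
qed (use assms in auto)

abbreviation delete_nth :: "nat \<Rightarrow> 'a list \<Rightarrow> 'a list" where
  "delete_nth i vs \<equiv> take i vs @ drop (Suc i) vs"

text \<open>This is the cancellation behind \<open>d \<circ> \<phi>\<^sup>* = \<phi>\<^sup>* \<circ> d\<close>, with \<open>B\<close> the second derivative of \<open>\<phi>\<close>. Each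
  summand belongs to an ordered pair of distinct entries of \<open>vs\<close>, the deleted one and the one replaced
  by a value of \<open>B\<close>. Exchanging the two roles leaves the value of \<open>B\<close> unchanged but moves it past
  the \<open>m\<close> entries between them; this contributes \<open>(-1)\<^sup>m\<close>, while the sign of the deleted position
  changes by \<open>(-1)\<^bsup>m+1\<^esup>\<close>, so the two summands cancel.\<close>

lemma alternating_cancel_symmetric:
  fixes A :: "'a \<Rightarrow> 'b::real_vector"
  assumes alt: "alternating k \<eta>" and sym: "\<And>v w. B v w = B w v" and len: "length vs = Suc k"
  shows "(\<Sum>i<Suc k. (-1) ^ i * (\<Sum>j<k. \<eta> ((map A (delete_nth i vs))[j := B (vs ! i) (delete_nth i vs ! j)]))) = 0"
proof -
  define t where "t = (\<lambda>(i, j). (-1) ^ i *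
    \<eta> ((map A (delete_nth i vs))[j := B (vs ! i) (delete_nth i vs ! j)]))"
  \<comment> \<open>Position \<open>j\<close> of the shortened list is entry \<open>j + 1\<close> of \<open>vs\<close> if \<open>i \<le> j\<close> and entry \<open>j\<close> otherwise,
    so exchanging the roles sends \<open>(i, j)\<close> in \<open>I\<close> to \<open>(j + 1, i)\<close> in \<open>J\<close>.\<close>
  define I where "I = {(i, j). i \<le> j \<and> j < k}"
  define J where "J = {(i, j). j < i \<and> i < Suc k}"
  have fin: "finite I" "finite J"
    by (rule finite_subset[of _ "{..k} \<times> {..k}"]; auto simp: I_def J_def)+
  have cancel: "t (i, j) = - t (Suc j, i)" if ij: "i \<le> j" "j < k" for i j
  proof -
    obtain xs a ys b zs where
      vs: "vs = xs @ a # ys @ b # zs" "length xs = i" "i + Suc (length ys) = Suc j"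
      by (rule split_at_two[of i "Suc j" vs]) (use ij len in auto)
    have j: "j = i + length ys" using vs(3) by simp
    have vi: "vs ! i = a" "vs ! Suc j = b" using vs(1,2) by (simp_all add: j nth_append)
    have di: "delete_nth i vs = xs @ ys @ b # zs" using vs by simp
    have dj: "delete_nth (Suc j) vs = xs @ a # ys @ zs" using vs(1,2) by (simp add: j Suc_diff_le)
    have "t (i, j) = (-1) ^ i * \<eta> (map A xs @ map A ys @ B a b # map A zs)"
      unfolding t_def prod.case vi di using vs(2) by (simp add: j nth_append list_update_append)
    moreover have "t (Suc j, i) = (-1) ^ Suc j * \<eta> (map A xs @ B b a # map A ys @ map A zs)"
      unfolding t_def prod.case vi dj using vs(2) by (simp add: nth_append list_update_append)
    ultimately show ?thesis
      unfolding sym[of b a] alternating_move[OF alt, of _ _ "map A ys"] j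
      by (simp add: power_add)
  qed
  have "(\<Sum>i<Suc k. (-1) ^ i * (\<Sum>j<k. \<eta> ((map A (delete_nth i vs))[j := B (vs ! i) (delete_nth i vs ! j)])))
      = (\<Sum>p\<in>{..<Suc k} \<times> {..<k}. t p)"
    by (simp add: sum_distrib_left sum.cartesian_product t_def)
  also have "{..<Suc k} \<times> {..<k} = I \<union> J" by (auto simp: I_def J_def)
  also have "sum t (I \<union> J) = sum t I + sum t J"
    using fin by (intro sum.union_disjoint) (auto simp: I_def J_def)
  also have "sum t J = (\<Sum>(i, j)\<in>I. t (Suc j, i))"
    by (rule sum.reindex_bij_witness[of _ "\<lambda>(i, j). (Suc j, i)" "\<lambda>(i, j). (j, i - 1)"])
      (auto simp: I_def J_def)
  also have "sum t I = (\<Sum>(i, j)\<in>I. - t (Suc j, i))"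
    by (intro sum.cong) (auto simp: I_def cancel)
  also have "\<dots> = - (\<Sum>(i, j)\<in>I. t (Suc j, i))"
    by (simp add: sum_negf case_prod_unfold)
  finally show ?thesis by simp
qed

text \<open>Smoothness of a form is known for constant arguments only. Expanding the arguments in a basis one
  at a time reduces varying arguments to constant ones.\<close>

lemma smooth_on_multilinear_form:
  fixes W :: "('a::real_normed_vector \<Rightarrow> 'b::euclidean_space) list"
  assumes "open S" "\<And>x. x \<in> S \<Longrightarrow> multilinear_form (length W) (\<zeta> x)"
    and "\<And>vs. length vs = length W \<Longrightarrow> smooth_on S (\<lambda>x. \<zeta> x vs)"
    and "\<And>w. w \<in> set W \<Longrightarrow> smooth_on S w"
  shows "smooth_on S (\<lambda>x. \<zeta> x (map (\<lambda>w. w x) W))"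
  using assms(2-)
proof (induction W arbitrary: \<zeta>)
  case (Cons w W)
  have 1: "smooth_on S (\<lambda>x. \<zeta> x (b # map (\<lambda>w. w x) W))" for b
    by (rule Cons.IH) (use Cons.prems in \<open>auto intro: multilinear_form_Cons\<close>)
  have 2: "smooth_on S w" using Cons.prems(3) by simp
  have "smooth_on S (\<lambda>x. \<Sum>b\<in>Basis. (w x \<bullet> b) *\<^sub>R \<zeta> x (b # map (\<lambda>w. w x) W))"
    using 1 2 unfolding smooth_on_def
    by (intro allI Ck_on_sum Ck_on_scaleR Ck_on_inner_left assms(1)) auto
  moreover have "(\<Sum>b\<in>Basis. (w x \<bullet> b) *\<^sub>R \<zeta> x (b # map (\<lambda>w. w x) W)) =
      \<zeta> x (map (\<lambda>w. w x) (w # W))" if "x \<in> S" for x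
    using multilinear_form_expand[of "length W" "\<zeta> x" "map (\<lambda>w. w x) W" "w x"] Cons.prems(1)[OF that]
    by simp
  ultimately show ?case by (rule smooth_on_cong[OF assms(1), rotated])
qed simp

text \<open>The product rule, proved by the same expansion in a basis.\<close>

lemma has_derivative_multilinear_form:
  fixes W :: "('a::real_normed_vector \<Rightarrow> 'b::euclidean_space) list"
  assumes "open S" "x \<in> S" "\<And>y. y \<in> S \<Longrightarrow> multilinear_form (length W) (\<zeta> y)"
    and "\<And>vs. length vs = length W \<Longrightarrow> ((\<lambda>y. \<zeta> y vs) has_derivative Z vs) (at x)"
    and "\<And>w. w \<in> set W \<Longrightarrow> (w has_derivative D w) (at x)"
  shows "((\<lambda>y. \<zeta> y (map (\<lambda>w. w y) W)) has_derivative
    (\<lambda>v. Z (map (\<lambda>w. w x) W) v +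
      (\<Sum>j<length W. \<zeta> x ((map (\<lambda>w. w x) W)[j := D (W ! j) v])))) (at x)"
  using assms(3-)
proof (induction W arbitrary: \<zeta> Z)
  case Nil
  then show ?case by simp
next
  case (Cons w W)
  define ws where "ws = map (\<lambda>w. w x) W"
  have ml: "multilinear_form (Suc (length W)) (\<zeta> y)" if "y \<in> S" for y
    using Cons.prems(1)[OF that] by simp
  note ex = multilinear_form_expand[OF ml]
  have 1: "((\<lambda>y. \<zeta> y (b # map (\<lambda>w. w y) W)) has_derivative
      (\<lambda>v. Z (b # ws) v + (\<Sum>j<length W. \<zeta> x (b # ws[j := D (W ! j) v])))) (at x)" for b
    unfolding ws_def using Cons.prems by (intro Cons.IH multilinear_form_Cons) auto
  have 2: "(w has_derivative D w) (at x)" using Cons.prems(3) by simp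
  \<comment> \<open>The derivative inherits linearity in the first argument, so the expansion can be undone.\<close>
  have Zlin: "Z (u # ws) = (\<lambda>v. \<Sum>b\<in>Basis. (u \<bullet> b) *\<^sub>R Z (b # ws) v)" for u
  proof (rule has_derivative_unique)
    show "((\<lambda>y. \<zeta> y (u # ws)) has_derivative Z (u # ws)) (at x)"
      by (rule Cons.prems(2)) (simp add: ws_def)
    have "((\<lambda>y. \<Sum>b\<in>Basis. (u \<bullet> b) *\<^sub>R \<zeta> y (b # ws)) has_derivative
        (\<lambda>v. \<Sum>b\<in>Basis. (u \<bullet> b) *\<^sub>R Z (b # ws) v)) (at x)"
      by (intro has_derivative_sum has_derivative_scaleR_right Cons.prems(2)) (simp add: ws_def)
    then show "((\<lambda>y. \<zeta> y (u # ws)) has_derivative (\<lambda>v. \<Sum>b\<in>Basis. (u \<bullet> b) *\<^sub>R Z (b # ws) v)) (at x)"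
      by (rule has_derivative_transform_within_open[OF _ assms(1,2)])
        (rule ex[symmetric], auto simp: ws_def)
  qed
  have "((\<lambda>y. \<Sum>b\<in>Basis. (w y \<bullet> b) *\<^sub>R \<zeta> y (b # map (\<lambda>w. w y) W)) has_derivative
      (\<lambda>v. \<Sum>b\<in>Basis. (w x \<bullet> b) *\<^sub>R (Z (b # ws) v + (\<Sum>j<length W. \<zeta> x (b # ws[j := D (W ! j) v])))
          + (D w v \<bullet> b) *\<^sub>R \<zeta> x (b # ws))) (at x)"
    unfolding ws_def using has_derivative_inner_left[OF 2] 1[unfolded ws_def]
    by (intro has_derivative_sum has_derivative_scaleR) auto
  also have "(\<lambda>v. \<Sum>b\<in>Basis. (w x \<bullet> b) *\<^sub>R (Z (b # ws) v + (\<Sum>j<length W. \<zeta> x (b # ws[j := D (W ! j) v])))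
          + (D w v \<bullet> b) *\<^sub>R \<zeta> x (b # ws)) =
      (\<lambda>v. Z (w x # ws) v + (\<Sum>j<length W. \<zeta> x (w x # ws[j := D (W ! j) v])) + \<zeta> x (D w v # ws))"
    (is "?l = ?r")
  proof
    fix v
    have e: "\<zeta> x (u # us) = (\<Sum>b\<in>Basis. (u \<bullet> b) *\<^sub>R \<zeta> x (b # us))" if "length us = length W" for u us
      by (rule ex[OF assms(2) that])
    have "(\<Sum>j<length W. \<zeta> x (w x # ws[j := D (W ! j) v])) =
       (\<Sum>j<length W. \<Sum>b\<in>Basis. (w x \<bullet> b) *\<^sub>R \<zeta> x (b # ws[j := D (W ! j) v]))"
      by (intro sum.cong refl e) (simp add: ws_def)
    also have "\<dots> = (\<Sum>b\<in>Basis. (w x \<bullet> b) *\<^sub>R (\<Sum>j<length W. \<zeta> x (b # ws[j := D (W ! j) v])))"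
      unfolding scaleR_sum_right by (rule sum.swap)
    finally show "?l v = ?r v"
      using e[of ws "D w v"] fun_cong[OF Zlin[of "w x"], of v]
      by (simp add: ws_def sum.distrib distrib_left)
  qed
  finally have "((\<lambda>y. \<zeta> y (map (\<lambda>w. w y) (w # W))) has_derivative ?r) (at x)"
    by (rule has_derivative_transform_within_open[OF _ assms(1,2)])
      (unfold list.map, rule ex[symmetric], auto)
  then show ?case by (simp add: sum.lessThan_Suc_shift ws_def algebra_simps del: sum.lessThan_Suc)
qed

text \<open>The product rule splits the derivative of each summand; the part with second derivatives of \<open>\<phi>\<close>
  is removed by \<open>alternating_cancel_symmetric\<close>.\<close>

lemma ext_deriv_flat_pullback:
  fixes \<phi> :: "'a::euclidean_space \<Rightarrow> 'b::euclidean_space"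
  assumes S: "open S" "x \<in> S" and C2: "Ck_on 2 S \<phi>" and T: "\<phi> ` S \<subseteq> T"
    and alt: "\<And>y. y \<in> T \<Longrightarrow> alternating k (\<eta> y)"
    and diff: "\<And>ws. length ws = k \<Longrightarrow> (\<lambda>y. \<eta> y ws) differentiable at (\<phi> x)"
    and len: "length vs = Suc k"
  shows "ext_deriv_flat (\<lambda>y ws. \<eta> (\<phi> y) (map (frechet_derivative \<phi> (at y)) ws)) x vs =
    ext_deriv_flat \<eta> (\<phi> x) (map (frechet_derivative \<phi> (at x)) vs)"
proof -
  define D where "D y = frechet_derivative \<phi> (at y)" for y
  define B where "B v w = frechet_derivative (\<lambda>z. D z w) (at x) v" for v w
  have \<phi>: "(\<phi> has_derivative D x) (at x)"
    and D: "((\<lambda>y. D y w) has_derivative (\<lambda>v. B v w)) (at x)" for w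
    unfolding D_def B_def using C2 S(2)
    by (auto intro!: has_frechet_derivative simp: numeral_2_eq_2)
  have Bsym: "B v w = B w v" for v w
    unfolding B_def D_def by (rule second_derivative_symmetric[OF S C2])
  have der: "frechet_derivative (\<lambda>y. \<eta> (\<phi> y) (map (D y) ws)) (at x) v =
      frechet_derivative (\<lambda>y. \<eta> y (map (D x) ws)) (at (\<phi> x)) (D x v) +
      (\<Sum>j<k. \<eta> (\<phi> x) ((map (D x) ws)[j := B v (ws ! j)]))" if ws: "length ws = k" for ws v
  proof -
    define W where "W = map (\<lambda>w y. D y w) ws"
    define DD where "DD w = frechet_derivative w (at x)" for w :: "'a \<Rightarrow> 'b"
    have "((\<lambda>y. \<eta> (\<phi> y) (map (\<lambda>w. w y) W)) has_derivative
      (\<lambda>v. frechet_derivative (\<lambda>y. \<eta> y (map (\<lambda>w. w x) W)) (at (\<phi> x)) (D x v) +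
        (\<Sum>j<length W. \<eta> (\<phi> x) ((map (\<lambda>w. w x) W)[j := DD (W ! j) v])))) (at x)"
    proof (rule has_derivative_multilinear_form[OF S])
      show "multilinear_form (length W) (\<eta> (\<phi> y))" if "y \<in> S" for y
        using alternating_multilinear[OF alt, of "\<phi> y"] T ws that by (auto simp: W_def)
      show "((\<lambda>y. \<eta> (\<phi> y) us) has_derivative
          (\<lambda>v. frechet_derivative (\<lambda>y. \<eta> y us) (at (\<phi> x)) (D x v))) (at x)"
        if "length us = length W" for us
        using diff_chain_at[OF \<phi> has_frechet_derivative[OF diff[of us]]] that ws
        by (simp add: o_def W_def)
      show "(w has_derivative DD w) (at x)" if "w \<in> set W" for w
        using that D frechet_derivative_at[OF D] by (auto simp: W_def DD_def)
    qed
    from fun_cong[OF frechet_derivative_at[OF this, symmetric], of v] show ?thesis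
      using ws by (simp add: W_def DD_def B_def comp_def)
  qed
  have "ext_deriv_flat (\<lambda>y ws. \<eta> (\<phi> y) (map (D y) ws)) x vs =
    (\<Sum>i<Suc k. (-1) ^ i * (frechet_derivative (\<lambda>y. \<eta> y (map (D x) (delete_nth i vs))) (at (\<phi> x)) (D x (vs ! i)) +
      (\<Sum>j<k. \<eta> (\<phi> x) ((map (D x) (delete_nth i vs))[j := B (vs ! i) (delete_nth i vs ! j)]))))"
    unfolding ext_deriv_flat_def len by (intro sum.cong refl arg_cong2[where f = times] der) (use len in auto)
  also have "\<dots> = (\<Sum>i<Suc k. (-1) ^ i *
      frechet_derivative (\<lambda>y. \<eta> y (map (D x) (delete_nth i vs))) (at (\<phi> x)) (D x (vs ! i)))"
    using alternating_cancel_symmetric[where B = B and A = "D x", OF alt Bsym len, of "\<phi> x"] T S(2)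
    by (auto simp: distrib_left sum.distrib simp del: sum.lessThan_Suc)
  also have "\<dots> = ext_deriv_flat \<eta> (\<phi> x) (map (D x) vs)"
    unfolding ext_deriv_flat_def
    by (intro sum.cong) (use len in \<open>auto simp: take_map drop_map\<close>)
  finally show ?thesis by (simp add: D_def)
qed

section \<open>Pullback of forms along a smooth map of manifolds\<close>

lemma frechet_derivative_eq_if_eq_near:
  assumes "open S" "x \<in> S" "\<And>y. y \<in> S \<Longrightarrow> f y = g y"
  shows "frechet_derivative f (at x) = frechet_derivative g (at x)"
proof -
  have "(f has_derivative D) (at x) \<longleftrightarrow> (g has_derivative D) (at x)" for D
    using has_derivative_transform_within_open[OF _ assms(1,2)] assms(3) by metis
  then show ?thesis by (simp add: frechet_derivative_def)
qed

lemma ext_deriv_flat_eq_if_eq_near: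
  assumes "open S" "x \<in> S" "\<And>y vs. y \<in> S \<Longrightarrow> \<eta> y vs = \<theta> y vs"
  shows "ext_deriv_flat \<eta> x = ext_deriv_flat \<theta> x"
  unfolding ext_deriv_flat_def
  using frechet_derivative_eq_if_eq_near[OF assms(1,2), of "\<lambda>y. \<eta> y vs" "\<lambda>y. \<theta> y vs" for vs] assms(3)
  by simp

lemma alternating_map:
  assumes L: "linear L" and alt: "alternating k \<eta>"
  shows "alternating k (\<lambda>vs. \<eta> (map L vs))"
  unfolding alternating_def
proof (intro conjI allI impI)
  fix vs :: "'a list" and i
  assume "length vs = k" "i < k"
  then have "linear (\<lambda>v. \<eta> ((map L vs)[i := v]))"
    using alt unfolding alternating_def by simp
  from linear_compose[OF L this] show "linear (\<lambda>v. \<eta> (map L (vs[i := v])))"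
    by (simp add: o_def map_update)
qed (use alt in \<open>auto simp: alternating_def\<close>)

lemma coord_change_has_derivative:
  assumes "smooth_manifold M" "c \<in> matlas M" "d \<in> matlas M" "p \<in> fst c" "p \<in> fst d"
  shows "(snd d \<circ> chart_inv c has_derivative coord_change c d p) (at (snd c p))"
proof -
  have "smooth_on (snd c ` (fst c \<inter> fst d)) (snd d \<circ> chart_inv c)"
    using assms unfolding smooth_manifold_def by blast
  from smooth_on_differentiable[OF this, of "snd c p"] show ?thesis
    unfolding coord_change_def using assms(4,5) by (intro has_frechet_derivative) auto
qed

lemma chart_rep_alternating:
  assumes "smooth_manifold M" "c \<in> matlas M" "p \<in> fst c" "p \<in> mcarrier M" "alternating k (\<eta> p)"
  shows "alternating k (chart_rep M c \<eta> (snd c p))"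
proof -
  have "linear (coord_change c (chart_at M p) p)"
    using coord_change_has_derivative[OF assms(1,2) _ assms(3)] chart_at_in[OF assms(1,4)]
      has_derivative_linear by blast
  from alternating_map[OF this assms(5)] show ?thesis
    by (simp add: chart_rep_def[abs_def] chart_inv_chart[OF assms(1-3)])
qed

text \<open>A form of degree \<open>k\<close> vanishes on lists of length other than \<open>k\<close>, so each term of \<open>d\<eta>\<close> on a
  list of length other than \<open>k + 1\<close> differentiates a function that is zero near the point.\<close>

lemma form_on_ext_deriv_wrong_length:
  assumes M: "smooth_manifold M" and W: "openin (mspace M) W" and \<eta>: "form_on M W k \<eta>"
    and p: "p \<in> W" and len: "length vs \<noteq> Suc k"
  shows "ext_deriv M \<eta> p vs = 0"
proof -
  have pM: "p \<in> mcarrier M" using W p openin_subset by blast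
  define c where "c = chart_at M p"
  note c = chart_at_in[OF M pM, folded c_def]
  define S where "S = snd c ` (fst c \<inter> W)"
  have S: "open S" unfolding S_def
    using W chart_facts(1)[OF M c(1)] by (intro chart_image_open[OF M c(1)]) auto
  have x: "snd c p \<in> S" using c p by (simp add: S_def)
  have "chart_rep M c \<eta> y ws = 0" if "y \<in> S" "length ws \<noteq> k" for y ws
    using that chart_inv_chart[OF M c(1)] \<eta>
    by (auto simp: S_def chart_rep_def form_on_def alternating_def)
  then have "frechet_derivative (\<lambda>y. chart_rep M c \<eta> y ws) (at (snd c p)) v = 0"
    if "length ws \<noteq> k" for ws v
    using frechet_derivative_eq_if_eq_near[OF S x, of "\<lambda>y. chart_rep M c \<eta> y ws" "\<lambda>y. 0"] that by simp
  then show ?thesis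
    using len unfolding ext_deriv_def ext_deriv_flat_def c_def[symmetric]
    by (intro sum.neutral) auto
qed

locale smooth_map_between =
  fixes M :: "('m, 'e::euclidean_space) mfd" and P :: "('p, 'g::euclidean_space) mfd"
    and U :: "'m set" and \<sigma> :: "'m \<Rightarrow> 'p"
  assumes M: "smooth_manifold M" and P: "smooth_manifold P" and \<sigma>: "smooth_map_on U M P \<sigma>"
begin

definition dom_rep :: "('m, 'e) chart \<Rightarrow> ('p, 'g) chart \<Rightarrow> 'm set" where
  "dom_rep c d = {p \<in> fst c \<inter> U. \<sigma> p \<in> fst d}"

abbreviation map_rep :: "('m, 'e) chart \<Rightarrow> ('p, 'g) chart \<Rightarrow> 'e \<Rightarrow> 'g" where
  "map_rep c d \<equiv> snd d \<circ> \<sigma> \<circ> chart_inv c"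

lemma openin_U: "openin (mspace M) U"
  using \<sigma> unfolding smooth_map_on_def by auto

lemma U_subset: "p \<in> U \<Longrightarrow> p \<in> mcarrier M"
  using openin_U openin_subset by blast

lemma map_in_carrier: "p \<in> U \<Longrightarrow> \<sigma> p \<in> mcarrier P"
  using \<sigma> openin_subset continuous_map_image_subset_topspace unfolding smooth_map_on_def by fastforce

lemma openin_dom_rep:
  assumes "c \<in> matlas M" "d \<in> matlas P"
  shows "openin (mspace M) (dom_rep c d)"
proof -
  have "openin (subtopology (mspace M) U) {p \<in> topspace (subtopology (mspace M) U). \<sigma> p \<in> fst d}"
    using \<sigma> chart_facts(1)[OF P assms(2)] unfolding smooth_map_on_def
    by (intro openin_continuous_map_preimage) auto
  moreover have "topspace (subtopology (mspace M) U) = U" using openin_subset[OF openin_U] by auto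
  ultimately have "openin (mspace M) {p \<in> U. \<sigma> p \<in> fst d}"
    using openin_U openin_trans_full by fastforce
  moreover have "dom_rep c d = fst c \<inter> {p \<in> U. \<sigma> p \<in> fst d}" by (auto simp: dom_rep_def)
  ultimately show ?thesis using chart_facts(1)[OF M assms(1)] by auto
qed

lemma open_dom_rep:
  assumes "c \<in> matlas M" "d \<in> matlas P"
  shows "open (snd c ` dom_rep c d)"
  by (rule chart_image_open[OF M assms(1) openin_dom_rep[OF assms]]) (auto simp: dom_rep_def)

lemma smooth_map_rep:
  assumes "c \<in> matlas M" "d \<in> matlas P"
  shows "smooth_on (snd c ` dom_rep c d) (map_rep c d)"
  using \<sigma> assms unfolding smooth_map_on_def dom_rep_def by blast

lemma map_rep_eq: "c \<in> matlas M \<Longrightarrow> p \<in> fst c \<Longrightarrow> map_rep c d (snd c p) = snd d (\<sigma> p)"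
  using chart_inv_chart[OF M] by simp

lemma map_rep_has_derivative:
  assumes "c \<in> matlas M" "d \<in> matlas P" "p \<in> dom_rep c d"
  shows "(map_rep c d has_derivative frechet_derivative (map_rep c d) (at (snd c p))) (at (snd c p))"
  using smooth_on_differentiable[OF smooth_map_rep[OF assms(1,2)]] assms(3)
  by (intro has_frechet_derivative) auto

text \<open>Both sides are derivatives of the representative of \<open>\<sigma>\<close> in the chart \<open>c\<close> and the chart preferred by
  \<open>\<sigma> p\<close>: one factors through the chart preferred by \<open>p\<close>, the other through \<open>d\<close>.\<close>

lemma mderiv_coord_change:
  assumes c: "c \<in> matlas M" and d: "d \<in> matlas P" and p: "p \<in> dom_rep c d"
  shows "mderiv M P \<sigma> p (coord_change c (chart_at M p) p v) =
    coord_change d (chart_at P (\<sigma> p)) (\<sigma> p) (frechet_derivative (map_rep c d) (at (snd c p)) v)"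
proof -
  define c' where "c' = chart_at M p"
  define d' where "d' = chart_at P (\<sigma> p)"
  have pU: "p \<in> U" "p \<in> fst c" "\<sigma> p \<in> fst d" using p by (auto simp: dom_rep_def)
  note c' = chart_at_in[OF M U_subset[OF pU(1)], folded c'_def]
  note d' = chart_at_in[OF P map_in_carrier[OF pU(1)], folded d'_def]
  define S where "S = snd c ` (dom_rep c d \<inter> dom_rep c' d')"
  have S: "open S" unfolding S_def
    by (rule chart_image_open[OF M c openin_Int[OF openin_dom_rep[OF c d] openin_dom_rep[OF c'(1) d'(1)]]])
      (auto simp: dom_rep_def)
  have x: "snd c p \<in> S" using p pU c' d' by (auto simp: S_def dom_rep_def)
  have 1: "(map_rep c' d' has_derivative mderiv M P \<sigma> p) (at (snd c' p))"
    using mderiv_has_derivative[OF M P \<sigma> pU(1)] by (simp add: c'_def d'_def)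
  have "(map_rep c' d' \<circ> (snd c' \<circ> chart_inv c) has_derivative
      mderiv M P \<sigma> p \<circ> coord_change c c' p) (at (snd c p))"
    using diff_chain_at[OF coord_change_has_derivative[OF M c c'(1) pU(2) c'(2)]] 1
      chart_inv_chart[OF M c pU(2)] by simp
  then have a: "(map_rep c d' has_derivative mderiv M P \<sigma> p \<circ> coord_change c c' p) (at (snd c p))"
    by (rule has_derivative_transform_within_open[OF _ S x])
      (use chart_inv_chart[OF M c] chart_inv_chart[OF M c'(1)] in \<open>auto simp: S_def dom_rep_def\<close>)
  have 2: "(snd d' \<circ> chart_inv d has_derivative coord_change d d' (\<sigma> p)) (at (map_rep c d (snd c p)))"
    using coord_change_has_derivative[OF P d d'(1) pU(3) d'(2)] map_rep_eq[OF c pU(2)] by simp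
  have "((snd d' \<circ> chart_inv d) \<circ> map_rep c d has_derivative
      coord_change d d' (\<sigma> p) \<circ> frechet_derivative (map_rep c d) (at (snd c p))) (at (snd c p))"
    by (rule diff_chain_at[OF map_rep_has_derivative[OF c d p] 2])
  then have b: "(map_rep c d' has_derivative
      coord_change d d' (\<sigma> p) \<circ> frechet_derivative (map_rep c d) (at (snd c p))) (at (snd c p))"
    by (rule has_derivative_transform_within_open[OF _ S x])
      (use chart_inv_chart[OF M c] chart_inv_chart[OF P d] in \<open>auto simp: S_def dom_rep_def\<close>)
  show ?thesis
    using fun_cong[OF has_derivative_unique[OF a b], of v] by (simp add: c'_def d'_def)
qed

text \<open>The right-hand side mentions preferred charts only through the representative of \<open>\<eta>\<close> in the
  fixed chart \<open>d\<close>. Hence smoothness and exterior derivatives of the pullback can be read off from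
  data on Euclidean spaces.\<close>

lemma chart_rep_pullback:
  assumes c: "c \<in> matlas M" and d: "d \<in> matlas P" and x: "x \<in> snd c ` dom_rep c d"
  shows "chart_rep M c (pullback M P \<sigma> \<eta>) x vs =
    chart_rep P d \<eta> (map_rep c d x) (map (frechet_derivative (map_rep c d) (at x)) vs)"
proof -
  obtain p where p: "p \<in> dom_rep c d" "x = snd c p" using x by blast
  then have "p \<in> fst c" "\<sigma> p \<in> fst d" by (auto simp: dom_rep_def)
  then show ?thesis
    using chart_inv_chart[OF M c] chart_inv_chart[OF P d] mderiv_coord_change[OF c d p(1)]
    by (simp add: chart_rep_def pullback_def p(2) comp_def Let_def)
qed

lemma map_rep_image: "c \<in> matlas M \<Longrightarrow> map_rep c d ` snd c ` dom_rep c d \<subseteq> snd d ` (fst d \<inter> mcarrier P)"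
  using map_rep_eq map_in_carrier by (fastforce simp: dom_rep_def)

lemma form_alternating:
  assumes "form_on P (mcarrier P) k \<eta>" "d \<in> matlas P" "y \<in> snd d ` (fst d \<inter> mcarrier P)"
  shows "alternating k (chart_rep P d \<eta> y)"
  using assms chart_rep_alternating[OF P assms(2)] unfolding form_on_def by blast

lemma form_on_pullback:
  assumes \<eta>: "form_on P (mcarrier P) k \<eta>"
  shows "form_on M U k (pullback M P \<sigma> \<eta>)"
  unfolding form_on_def
proof (intro conjI ballI allI impI)
  fix p assume p: "p \<in> U"
  have "linear (mderiv M P \<sigma> p)"
    using mderiv_has_derivative[OF M P \<sigma> p] has_derivative_linear by blast
  from alternating_map[OF this] show "alternating k (pullback M P \<sigma> \<eta> p)"
    using \<eta> map_in_carrier[OF p] by (simp add: pullback_def[abs_def] form_on_def)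
next
  fix c and vs :: "'e list" assume c: "c \<in> matlas M" and vs: "length vs = k"
  show "smooth_on (snd c ` (fst c \<inter> U)) (\<lambda>x. chart_rep M c (pullback M P \<sigma> \<eta>) x vs)"
  proof (rule smooth_on_local)
    fix x assume "x \<in> snd c ` (fst c \<inter> U)"
    then obtain p where p: "p \<in> fst c" "p \<in> U" "x = snd c p" by blast
    define d where "d = chart_at P (\<sigma> p)"
    note d = chart_at_in[OF P map_in_carrier[OF p(2)], folded d_def]
    define S where "S = snd c ` dom_rep c d"
    define W where "W = map (\<lambda>v x. frechet_derivative (map_rep c d) (at x) v) vs"
    have S: "open S" "x \<in> S"
      using open_dom_rep[OF c d(1)] p d by (auto simp: S_def dom_rep_def)
    have img: "map_rep c d ` S \<subseteq> snd d ` (fst d \<inter> mcarrier P)"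
      unfolding S_def by (rule map_rep_image[OF c])
    have "smooth_on S (\<lambda>x. chart_rep P d \<eta> (map_rep c d x) (map (\<lambda>w. w x) W))"
    proof (rule smooth_on_multilinear_form[OF S(1)])
      show "multilinear_form (length W) (chart_rep P d \<eta> (map_rep c d x))" if "x \<in> S" for x
        using alternating_multilinear[OF form_alternating[OF \<eta> d(1), of "map_rep c d x"]] img that vs
        by (auto simp: W_def)
      have "smooth_on (snd d ` (fst d \<inter> mcarrier P)) (\<lambda>y. chart_rep P d \<eta> y ws)"
        if "length ws = length W" for ws
        using \<eta> d(1) that vs by (auto simp: form_on_def W_def)
      then show "smooth_on S (\<lambda>x. chart_rep P d \<eta> (map_rep c d x) ws)" if "length ws = length W" for ws
        using smooth_on_compose[OF S(1) smooth_map_rep[OF c d(1), folded S_def] _ img] that by blast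
      show "smooth_on S w" if "w \<in> set W" for w
        using that smooth_on_frechet_derivative[OF smooth_map_rep[OF c d(1), folded S_def]]
        by (auto simp: W_def)
    qed
    then have "smooth_on S (\<lambda>x. chart_rep M c (pullback M P \<sigma> \<eta>) x vs)"
      by (rule smooth_on_cong[OF S(1), rotated])
        (simp add: chart_rep_pullback[OF c d(1)] S_def W_def comp_def)
    then show "\<exists>T. open T \<and> x \<in> T \<and> smooth_on T (\<lambda>x. chart_rep M c (pullback M P \<sigma> \<eta>) x vs)"
      using S by blast
  qed
qed

lemma ext_deriv_pullback:
  assumes \<eta>: "form_on P (mcarrier P) k \<eta>" and p: "p \<in> U" and vs: "length vs = Suc k"
  shows "ext_deriv M (pullback M P \<sigma> \<eta>) p vs = ext_deriv P \<eta> (\<sigma> p) (map (mderiv M P \<sigma> p) vs)"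
proof -
  define c where "c = chart_at M p"
  define d where "d = chart_at P (\<sigma> p)"
  note c = chart_at_in[OF M U_subset[OF p], folded c_def]
  note d = chart_at_in[OF P map_in_carrier[OF p], folded d_def]
  define S where "S = snd c ` dom_rep c d"
  have S: "open S" "snd c p \<in> S"
    using open_dom_rep[OF c(1) d(1)] p c d by (auto simp: S_def dom_rep_def)
  have "ext_deriv M (pullback M P \<sigma> \<eta>) p vs =
      ext_deriv_flat (\<lambda>x ws. chart_rep P d \<eta> (map_rep c d x)
        (map (frechet_derivative (map_rep c d) (at x)) ws)) (snd c p) vs"
    unfolding ext_deriv_def c_def[symmetric]
    by (rule fun_cong[OF ext_deriv_flat_eq_if_eq_near[OF S]])
      (simp only: chart_rep_pullback[OF c(1) d(1)] S_def)
  also have "\<dots> = ext_deriv_flat (chart_rep P d \<eta>) (map_rep c d (snd c p))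
      (map (frechet_derivative (map_rep c d) (at (snd c p))) vs)"
  proof (rule ext_deriv_flat_pullback[OF S _ _ _ _ vs])
    show "Ck_on 2 S (map_rep c d)"
      using smooth_map_rep[OF c(1) d(1)] by (simp add: smooth_on_def S_def)
    show "map_rep c d ` S \<subseteq> snd d ` (fst d \<inter> mcarrier P)"
      unfolding S_def by (rule map_rep_image[OF c(1)])
    show "alternating k (chart_rep P d \<eta> y)" if "y \<in> snd d ` (fst d \<inter> mcarrier P)" for y
      by (rule form_alternating[OF \<eta> d(1) that])
    show "(\<lambda>y. chart_rep P d \<eta> y ws) differentiable at (map_rep c d (snd c p))" if "length ws = k" for ws
    proof (rule smooth_on_differentiable)
      show "smooth_on (snd d ` (fst d \<inter> mcarrier P)) (\<lambda>y. chart_rep P d \<eta> y ws)"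
        using \<eta> d(1) that by (simp add: form_on_def)
      show "map_rep c d (snd c p) \<in> snd d ` (fst d \<inter> mcarrier P)"
        using map_rep_image[OF c(1), of d] S(2) unfolding S_def by blast
    qed
  qed
  also have "\<dots> = ext_deriv P \<eta> (\<sigma> p) (map (mderiv M P \<sigma> p) vs)"
    using map_rep_eq[OF c] by (simp add: ext_deriv_def mderiv_def c_def d_def)
  finally show ?thesis .
qed

end

section \<open>Contraction with a jet and the Noether theorem\<close>

lemma proj_along_eq:
  assumes "complement V H" "subspace V" "v \<in> V" "h \<in> H"
  shows "proj_along V H (v + h) = h"
  unfolding proj_along_def
proof (rule the_equality)
  fix h' assume h': "h' \<in> H \<and> v + h - h' \<in> V"
  have "h - h' \<in> H" using h' assms unfolding complement_def by (meson subspace_diff)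
  moreover have "h - h' \<in> V"
    using subspace_diff[OF assms(2), of "v + h - h'" v] h' assms(3) by simp
  ultimately have "h - h' \<in> V \<inter> H" by blast
  moreover have "V \<inter> H = {0}" using assms(1) by (simp add: complement_def)
  ultimately show "h' = h" by auto
qed (use assms in auto)

lemma complement_commute:
  assumes "subspace V" "complement V H"
  shows "complement H V"
  unfolding complement_def
proof (intro conjI allI)
  show "H \<inter> V = {0}" using assms(2) by (auto simp: complement_def)
  fix v
  obtain w h where "w \<in> V" "h \<in> H" "v = w + h" using assms(2) unfolding complement_def by blast
  then show "\<exists>w\<in>H. \<exists>h\<in>V. v = w + h" by (auto intro: bexI[of _ h] bexI[of _ w] simp: add.commute)
qed (use assms in auto)

text \<open>A set of \<open>n\<close> out of \<open>n + 1\<close> arguments either contains the first, and then the horizontal part of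
  \<open>v\<close>, which is zero, enters; or it consists of all the others, which are their own horizontal parts.\<close>

lemma hor_component_vertical_head:
  assumes comp: "complement V H" "subspace V" and alt: "alternating (Suc n) \<eta>"
    and v: "v \<in> V" and hs: "set hs \<subseteq> H" "length hs = n"
  shows "hor_component V H n \<eta> (v # hs) = \<eta> (v # hs)"
proof -
  have H: "subspace H" using comp by (simp add: complement_def)
  have V0: "0 \<in> V" and H0: "0 \<in> H" using comp H subspace_0 by auto
  have pV: "proj_along V H w = 0" "proj_along H V w = w" if "w \<in> V" for w
    using proj_along_eq[OF comp that H0] proj_along_eq[OF complement_commute[OF comp(2,1)] H H0 that]
    by auto
  have pH: "proj_along V H h = h" if "h \<in> H" for h
    using proj_along_eq[OF comp V0 that] by auto
  let ?args = "\<lambda>I. map (\<lambda>i. if i \<in> I then proj_along V H ((v # hs) ! i)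
      else proj_along H V ((v # hs) ! i)) [0..<length (v # hs)]"
  let ?A = "{I. I \<subseteq> {..<length (v # hs)} \<and> card I = n}"
  have fin: "finite ?A" by (rule finite_subset[of _ "Pow {..<length (v # hs)}"]) auto
  have top: "{1..<Suc n} \<in> ?A" using hs by auto
  have zero: "\<eta> (?args I) = 0" if I: "I \<in> ?A" "I \<noteq> {1..<Suc n}" for I
  proof -
    have "0 \<in> I"
    proof (rule ccontr)
      assume "0 \<notin> I"
      then have "I \<subseteq> {1..<Suc n}" using I hs(2) by (fastforce simp: Suc_le_eq)
      then show False using card_subset_eq[of "{1..<Suc n}" I] I by simp
    qed
    then obtain us where us: "?args I = 0 # us" "length us = n"
      using pV(1)[OF v] hs(2) by (simp add: upt_conv_Cons del: upt_Suc)
    show ?thesis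
      using linear_0[OF multilinear_form_head[OF alternating_multilinear[OF alt] us(2)]] us(1) by simp
  qed
  have args: "?args {1..<Suc n} = v # hs"
  proof (rule nth_equalityI)
    fix i assume i: "i < length (?args {1..<Suc n})"
    show "?args {1..<Suc n} ! i = (v # hs) ! i"
    proof (cases i)
      case 0
      then show ?thesis using pV(2)[OF v] by (simp del: upt_Suc)
    next
      case (Suc j)
      then have "hs ! j \<in> H" "j < n" using i hs by auto
      then show ?thesis using pH i Suc by (simp del: upt_Suc)
    qed
  qed simp
  have "hor_component V H n \<eta> (v # hs) = (\<Sum>I\<in>?A. \<eta> (?args I))"
    by (simp add: hor_component_def)
  also have "\<dots> = \<eta> (?args {1..<Suc n})"
    using sum.mono_neutral_right[OF fin, of "{{1..<Suc n}}" "\<lambda>I. \<eta> (?args I)"] top zero by auto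
  finally show ?thesis using args by simp
qed

theorem proposition6p2:
  fixes P :: "('p, 'g::euclidean_space) mfd"
    and M :: "('m, 'e::euclidean_space) mfd"
    and F :: "('q, 'f::real_normed_vector) mfd"
    and \<alpha> :: "'p \<Rightarrow> 'm"
    and \<omega> f :: "('p, 'g) dform"
    and Y :: "'p \<Rightarrow> 'g"
    and n :: nat
  assumes fib: "fiber_bundle P M F \<alpha>"
    and connected_fiber: "connected_space (mspace F)"
    and dim: "mdim M = n"
    and system: "PD_prehamiltonian P M \<alpha> \<omega>"
    and symmetry: "Y \<in> PD_Noether_symmetries P M \<alpha> \<omega>"
    and current: "f \<in> PD_Noether_currents P M \<alpha> \<omega>"
    and relation: "PD_Noether_pair P M \<alpha> \<omega> Y f"
  shows "\<forall>U \<sigma>. PD_Hamilton_solution P M \<alpha> \<omega> U \<sigma> \<longrightarrow>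
           closed_form_on M U (n - 1) (pullback M P \<sigma> f)"
proof (intro allI impI)
  fix U \<sigma> assume sol: "PD_Hamilton_solution P M \<alpha> \<omega> U \<sigma>"
  have mP: "smooth_manifold P" and mM: "smooth_manifold M"
    and a: "smooth_map_on (mcarrier P) P M \<alpha>"
    using fib unfolding fiber_bundle_def by auto
  have sec: "local_section P M \<alpha> U \<sigma>"
    and eqn: "\<And>x vs. x \<in> U \<Longrightarrow> jet_contract P M \<alpha> (jet_prolong P M \<sigma> x) \<omega> vs = 0"
    using sol unfolding PD_Hamilton_solution_def by auto
  interpret smooth_map_between M P U \<sigma>
    using mM mP sec by unfold_locales (auto simp: local_section_def)
  have n: "n > 0" using dim DIM_positive[where 'a = 'e] by (simp add: mdim_def)
  have f: "form_on P (mcarrier P) (n - 1) f"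
    and Yf: "forms_eq P (mcarrier P) (int_prod Y \<omega>) (ext_deriv P f)"
    and Y: "\<And>y. y \<in> mcarrier P \<Longrightarrow> Y y \<in> vertical_space P M \<alpha> y"
    using relation dim
    by (auto simp: PD_Noether_pair_def Omega_def Lambda_def vertical_fields_def)
  have \<omega>: "form_on P (mcarrier P) (Suc n) \<omega>"
    using system dim n by (simp add: PD_prehamiltonian_def Omega_def Lambda_def numeral_2_eq_2)
  have "ext_deriv M (pullback M P \<sigma> f) x vs = 0" if x: "x \<in> U" for x vs
  proof (cases "length vs = n")
    case True
    define V where "V = vertical_space P M \<alpha> (\<sigma> x)"
    define H where "H = range (mderiv M P \<sigma> x)"
    note \<sigma>x = map_in_carrier[OF x]
    have "linear (mderiv P M \<alpha> (\<sigma> x))"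
      using mderiv_has_derivative[OF P M a \<sigma>x] has_derivative_linear by blast
    then have V: "subspace V"
      using linear_subspace_kernel by (auto simp: V_def vertical_space_def)
    have VH: "complement V H"
      using jet_prolong_in_jet1[OF fib sec x] by (simp add: jet1_def jet_prolong_def V_def H_def)
    have "ext_deriv M (pullback M P \<sigma> f) x vs = \<omega> (\<sigma> x) (Y (\<sigma> x) # map (mderiv M P \<sigma> x) vs)"
      using ext_deriv_pullback[OF f x, of vs] True n Yf \<sigma>x by (simp add: forms_eq_def int_prod_def)
    also have "\<dots> = hor_component V H n (\<omega> (\<sigma> x)) (Y (\<sigma> x) # map (mderiv M P \<sigma> x) vs)"
      using \<omega> \<sigma>x Y[OF \<sigma>x] True
      by (intro hor_component_vertical_head[OF VH V, symmetric]) (auto simp: form_on_def V_def H_def)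
    also have "\<dots> = 0"
      using eqn[OF x] dim by (simp add: jet_contract_def jet_prolong_def V_def H_def)
    finally show ?thesis .
  next
    case False
    then show ?thesis
      using form_on_ext_deriv_wrong_length[OF M openin_U form_on_pullback[OF f] x, of vs] n by simp
  qed
  then show "closed_form_on M U (n - 1) (pullback M P \<sigma> f)"
    using form_on_pullback[OF f] by (simp add: closed_form_on_def forms_eq_def)
qed

end
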